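(* Assume the standing assumptions (f), (g), ($\nu$), (A) listed in the context. Let $(x(\cdot),u(\cdot),a(\cdot),\bar T)$ be a feasible solution of the constrained controlled sweeping process (as defined in the context) such that $a(\cdot),\dot u(\cdot),\dot x(\cdot)$ are of bounded variation on $[0,\bar T]$. For each $k\in\mathbb N$ let $h_k:=\bar T/k$ and $t^k_j:=jh_k$, $j=0,\dots,k$. Assume that for some constant $\mu>0$ (independent of $k$) $$\max\{\mathrm{var}(\dot x(\cdot);[0,\bar T]),\ \mathrm{var}(\dot u(\cdot);[0,\bar T]),\ \mathrm{var}(a(\cdot);[0,\bar T])\}\le\mu,\qquad \max\Big\{\Big\|\frac{u(t^k_1)-u(0)}{h_k}\Big\|,\Big\|\frac{u(\bar T)-u(t^k_{k-1})}{h_k}\Big\|\Big\}\le\mu .$$ Then there exist sequences of positive numbers $\{\delta_k\}$ and $\{\mu^x_k\}$ converging to zero as $k\to\infty$, piecewise linear functions $(x^k(\cdot),u^k(\cdot))$ on $[0,\bar T]$ (with nodes $t^k_j$) and piecewise constant functions $a^k(\cdot)$ (on the mesh $\{t^k_j\}$), such that for $j=0,\dots,k$ $$u^k(t^k_j)\in U_k:=\bigcap_{i=1}^s\nu_i^{-1}\big((-\infty,L_\nu\delta_k)\big),\qquad a^k(t^k_j)\in A,$$ $$(x^k(\bar T),\bar T)\in(\Xi_x+\mu^x_kB(0,1))\times\Xi_T,$$ for $j=0,\dots,k-1$ $$x^k(t)=x^k(t^k_j)+(t-t^k_j)v^k_j\ \text{ for } t^k_j\le t\le t^k_{j+1},\qquad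 -v^k_j\in F\big(x^k(t^k_j),u^k(t^k_j),a^k(t^k_j)\big),$$ and $g_i(x^k(0)-u^k(0))\ge0$ for all $i=1,\dots,m$; moreover, $(x^k(\cdot),u^k(\cdot))\to(x(\cdot),u(\cdot))$ uniformly on $[0,\bar T]$ and $(\dot x^k(\cdot),\dot u^k(\cdot),a^k(\cdot))\to(\dot x(\cdot),\dot u(\cdot),a(\cdot))$ in the $L^2$-norm on $[0,\bar T]$ as $k\to\infty$. Moreover, for every $k\in\mathbb N$, $$\mathrm{var}(\dot u^k;[0,\bar T])\le\tilde\mu\quad\text{and}\quad\max\Big\{\Big\|\frac{u^k(t^k_1)-u^k(0)}{h_k}\Big\|,\Big\|\frac{u^k(\bar T)-u^k(t^k_{k-1})}{h_k}\Big\|\Big\}\le\tilde\mu,$$ where $$\tilde\mu:=\max\big\{3\mu+1+4L_f\bar T\mu e^{L_f\bar T}(2L_f+1)+2L_f\mu,\ \ 2e^{L_f\bar T}(2L_f+1)(\mu+1)+\mu\big\}.$$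
   Context: Data. $f:\mathbb R^n\times\mathbb R^d\to\mathbb R^n$; $g_i:\mathbb R^n\to\mathbb R$ ($i=1,\dots,m$) convex and twice continuously differentiable; $\nu_i:\mathbb R^n\to\mathbb R$ ($i=1,\dots,s$) continuously differentiable with Jacobian of full rank; $A\subset\mathbb R^d$ nonempty; $\Xi_x\subset\mathbb R^n$, $\Xi_T\subset[0,\infty)$; $x_0\in\mathbb R^n$. Put $C_i:=\{x\in\mathbb R^n: g_i(x)\ge0\}$, $C:=\bigcap_{i=1}^mC_i$, $C_u:=C+u$ for $u\in\mathbb R^n$, $U_i:=\nu_i^{-1}((-\infty,0])$, $U:=\bigcap_{i=1}^sU_i$. $B(z,r)$ is the ball with center $z$ and radius $r$; $\mathrm{var}$ denotes total variation; norms are Euclidean. Normal cone. $N_\Omega(\bar x)$ is the limiting (Mordukhovich) normal cone: for $\bar x\in\Omega$, $N_\Omega(\bar x)=\{v:\exists x_k\to\bar x,\ w_k\in\Pi(x_k;\Omega),\ \alpha_k\ge0,\ \alpha_k(x_k-w_k)\to v\}$ with $\Pi(x;\Omega)$ the Euclidean projection set, and $N_\Omega(\bar x)=\emptyset$ if $\bar x\notin\Omega$. Velocity mapping: $F(x,u,a):=N_C(x-u)-f(x,a)$. Feasible solution: a quadruple $(x,u,a,T)$ with $x,u\in W^{1,2}([0,T];\mathbb R^n)$, $a\in L^2([0,T];\mathbb R^d)$ such that $-\dot x(t)\in F(x(t),u(t),a(t))$, $u(t)\in U$, $a(t)\in A$ for a.e. $t\in[0,T]$, $x(0)=x_0\in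 C_{u(0)}$, and $(x(T),T)\in\Xi_x\times\Xi_T$. Standing assumptions. (f) There is $L_f>0$ with $\|f(x_1,a_1)-f(x_2,a_2)\|\le L_f(\|x_1-x_2\|+\|a_1-a_2\|)$ for all $x_1,x_2\in\mathbb R^n$, $a_1,a_2\in\mathbb R^d$; and there is $M>0$ with $\|f(x,a)\|\le M(1+\|x\|)$ for all $x\in\bigcup_{t\in[0,T],T\ge0}C_{u(t)}$, $a\in\mathbb R^d$. (g) The $g_i$ are $C^2$ on $\mathbb R^n$; there are constants $c,M_1,M_2,M_3>0$ and open sets $V_i\supset C_i$ with $d_H(C_i,\mathbb R^n\setminus V_i)>c$ ($d_H$ the Hausdorff distance) and $M_1\le\|\nabla g_i(x)\|\le M_2$, $\|\nabla^2g_i(x)\|\le M_3$ for all $x\in V_i$, $i=1,\dots,m$; there are $\beta,\rho>0$ with $\sum_{i\in I_\rho(x)}\lambda_i\|\nabla g_i(x)\|\le\beta\|\sum_{i\in I_\rho(x)}\lambda_i\nabla g_i(x)\|$ for all $x\in C$, $\lambda_i\ge0$, where $I_\rho(x):=\{i: g_i(x)\le\rho\}$. ($\nu$) There is $L_\nu>0$ with $|\nu_i(u_2)-\nu_i(u_1)|\le L_\nu\|u_2-u_1\|$ for all $u_1,u_2\in\mathbb R^n$, $i=1,\dots,s$, and $\max_i\|\nabla\nu_i(u)\|\le L_\nu$ for all $u$; and if $u\in U$, $v_i\in N_{U_i}(u)$, $\sum_{i=1}^sv_i=0$, then $v_i=0$ for all $i$. (A) $A$ is compact and $f(x,A):=\{f(x,a):a\in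 A\}$ is convex for each $x\in\mathbb R^n$. *)

theory Defs
  imports "HOL-Analysis.Analysis"
begin

section \<open>Derivatives of functions on Euclidean space\<close>

definition grad :: "(real^'n \<Rightarrow> real) \<Rightarrow> real^'n \<Rightarrow> real^'n" where
  "grad g x = (\<chi> i. frechet_derivative g (at x) (axis i 1))"

definition hessian :: "(real^'n \<Rightarrow> real) \<Rightarrow> real^'n \<Rightarrow> real^'n^'n" where
  "hessian g x = jacobian (grad g) (at x)"

definition C1_fun :: "(real^'n \<Rightarrow> real) \<Rightarrow> bool" where
  "C1_fun g \<longleftrightarrow> (\<forall>x. g differentiable (at x)) \<and> continuous_on UNIV (grad g)"

definition C2_fun :: "(real^'n \<Rightarrow> real) \<Rightarrow> bool" where
  "C2_fun g \<longleftrightarrow> C1_fun g \<and> (\<forall>x. grad g differentiable (at x)) \<and> continuous_on UNIV (hessian g)"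

section \<open>Distances, projections and normal cones\<close>

text \<open>The Hausdorff distance takes the value \<open>\<infinity>\<close> for unbounded excess, and also between
  a nonempty set and the empty set (relevant when some neighbourhood \<open>V i\<close> below is the whole space).\<close>

definition Hausdorff_dist :: "'a::metric_space set \<Rightarrow> 'a set \<Rightarrow> ennreal" where
  "Hausdorff_dist A B =
     max (SUP x\<in>A. INF y\<in>B. ennreal (dist x y)) (SUP y\<in>B. INF x\<in>A. ennreal (dist x y))"

definition proj_set :: "'a::euclidean_space \<Rightarrow> 'a set \<Rightarrow> 'a set" where
  "proj_set x \<Omega> = {w \<in> \<Omega>. \<forall>y\<in>\<Omega>. dist x w \<le> dist x y}"

text \<open>Limiting (Mordukhovich) normal cone, empty off the set.\<close>

definition normal_cone :: "'a::euclidean_space set \<Rightarrow> 'a \<Rightarrow> 'a set" where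
  "normal_cone \<Omega> xb =
     (if xb \<in> \<Omega>
      then {v. \<exists>(xs::nat \<Rightarrow> 'a) ws \<alpha>.
                 xs \<longlonglongrightarrow> xb \<and> (\<forall>k. ws k \<in> proj_set (xs k) \<Omega>) \<and> (\<forall>k. 0 \<le> \<alpha> k) \<and>
                 (\<lambda>k. \<alpha> k *\<^sub>R (xs k - ws k)) \<longlonglongrightarrow> v}
      else {})"

section \<open>Function spaces on \<open>[0,T]\<close>\<close>

definition total_variation :: "(real \<Rightarrow> 'a::real_normed_vector) \<Rightarrow> real \<Rightarrow> real \<Rightarrow> ennreal" where
  "total_variation y a b =
     (SUP (N, p) \<in> {(N::nat, p::nat \<Rightarrow> real).
          (\<forall>i\<le>N. p i \<in> {a..b}) \<and> (\<forall>i<N. p i \<le> p (Suc i))}.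
        \<Sum>i<N. ennreal (norm (y (p (Suc i)) - y (p i))))"

definition bounded_variation :: "(real \<Rightarrow> 'a::real_normed_vector) \<Rightarrow> real \<Rightarrow> real \<Rightarrow> bool" where
  "bounded_variation y a b \<longleftrightarrow> total_variation y a b < \<infinity>"

definition L2_space :: "real \<Rightarrow> (real \<Rightarrow> 'a::euclidean_space) set" where
  "L2_space T = {y. y \<in> borel_measurable (lebesgue_on {0..T}) \<and>
                    integrable (lebesgue_on {0..T}) (\<lambda>t. (norm (y t))\<^sup>2)}"

definition L2_norm :: "real \<Rightarrow> (real \<Rightarrow> 'a::euclidean_space) \<Rightarrow> real" where
  "L2_norm T y = sqrt (\<integral>t. (norm (y t))\<^sup>2 \<partial>lebesgue_on {0..T})"

text \<open>The membership clause is needed because the Bochner integral of a non-integrable function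
  is \<open>0\<close>.\<close>

definition L2_tendsto :: "real \<Rightarrow> (nat \<Rightarrow> real \<Rightarrow> 'a::euclidean_space) \<Rightarrow> (real \<Rightarrow> 'a) \<Rightarrow> bool" where
  "L2_tendsto T ys y \<longleftrightarrow>
     (\<forall>\<^sub>F k in sequentially. (\<lambda>t. ys k t - y t) \<in> L2_space T) \<and>
     (\<lambda>k. L2_norm T (\<lambda>t. ys k t - y t)) \<longlonglongrightarrow> 0"

definition abs_continuous :: "real \<Rightarrow> (real \<Rightarrow> 'a::euclidean_space) \<Rightarrow> bool" where
  "abs_continuous T y \<longleftrightarrow>
     (\<forall>\<epsilon>>0. \<exists>\<delta>>0. \<forall>(N::nat) s t.
        (\<forall>i<N. 0 \<le> s i \<and> s i \<le> t i \<and> t i \<le> T) \<and>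
        (\<forall>i<N. \<forall>j<N. i \<noteq> j \<longrightarrow> {s i<..<t i} \<inter> {s j<..<t j} = {}) \<and>
        (\<Sum>i<N. t i - s i) < \<delta> \<longrightarrow>
        (\<Sum>i<N. norm (y (t i) - y (s i))) < \<epsilon>)"

text \<open>The derivative of a function on \<open>[0,T]\<close> is only determined almost everywhere;
  \<open>is_derivative T y dy\<close> says that \<open>dy\<close> is a representative of it. The variation of a derivative
  always refers to such a representative.\<close>

definition is_derivative :: "real \<Rightarrow> (real \<Rightarrow> 'a::euclidean_space) \<Rightarrow> (real \<Rightarrow> 'a) \<Rightarrow> bool" where
  "is_derivative T y dy \<longleftrightarrow>
     (AE t in lebesgue_on {0..T}. (y has_vector_derivative dy t) (at t within {0..T}))"

definition W12_space :: "real \<Rightarrow> (real \<Rightarrow> 'a::euclidean_space) set" where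
  "W12_space T = {y. abs_continuous T y \<and> (\<exists>dy \<in> L2_space T. is_derivative T y dy)}"

section \<open>The controlled sweeping process\<close>

definition C_comp :: "('m \<Rightarrow> real^'n \<Rightarrow> real) \<Rightarrow> 'm \<Rightarrow> (real^'n) set" where
  "C_comp g i = {x. 0 \<le> g i x}"

definition C_set :: "('m \<Rightarrow> real^'n \<Rightarrow> real) \<Rightarrow> (real^'n) set" where
  "C_set g = (\<Inter>i. C_comp g i)"

definition C_moved :: "('m \<Rightarrow> real^'n \<Rightarrow> real) \<Rightarrow> real^'n \<Rightarrow> (real^'n) set" where
  "C_moved g u = (\<lambda>y. y + u) ` C_set g"

definition U_comp :: "('s \<Rightarrow> real^'n \<Rightarrow> real) \<Rightarrow> 's \<Rightarrow> (real^'n) set" where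
  "U_comp \<nu> i = \<nu> i -` {..0}"

definition U_set :: "('s \<Rightarrow> real^'n \<Rightarrow> real) \<Rightarrow> (real^'n) set" where
  "U_set \<nu> = (\<Inter>i. U_comp \<nu> i)"

definition vel_map ::
  "(real^'n \<Rightarrow> real^'d \<Rightarrow> real^'n) \<Rightarrow> ('m \<Rightarrow> real^'n \<Rightarrow> real) \<Rightarrow>
   real^'n \<Rightarrow> real^'n \<Rightarrow> real^'d \<Rightarrow> (real^'n) set" where
  "vel_map f g x u a = {v - f x a | v. v \<in> normal_cone (C_set g) (x - u)}"

definition feasible ::
  "(real^'n \<Rightarrow> real^'d \<Rightarrow> real^'n) \<Rightarrow> ('m \<Rightarrow> real^'n \<Rightarrow> real) \<Rightarrow> ('s \<Rightarrow> real^'n \<Rightarrow> real) \<Rightarrow>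
   (real^'d) set \<Rightarrow> (real^'n) set \<Rightarrow> real set \<Rightarrow> real^'n \<Rightarrow>
   (real \<Rightarrow> real^'n) \<Rightarrow> (real \<Rightarrow> real^'n) \<Rightarrow> (real \<Rightarrow> real^'d) \<Rightarrow> real \<Rightarrow> bool" where
  "feasible f g \<nu> A \<Xi>x \<Xi>T x0 x u a T \<longleftrightarrow>
     x \<in> W12_space T \<and> u \<in> W12_space T \<and> a \<in> L2_space T \<and>
     (AE t in lebesgue_on {0..T}.
        - vector_derivative x (at t within {0..T}) \<in> vel_map f g (x t) (u t) (a t) \<and>
        u t \<in> U_set \<nu> \<and> a t \<in> A) \<and>
     x 0 = x0 \<and> x0 \<in> C_moved g (u 0) \<and>
     (x T, T) \<in> \<Xi>x \<times> \<Xi>T"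

section \<open>Standing assumptions\<close>

text \<open>The linear growth bound in the paper is imposed along the moving set; here \<open>u\<close> on \<open>[0,T]\<close>
  is the control function of the process under consideration.\<close>

definition assm_f ::
  "(real^'n \<Rightarrow> real^'d \<Rightarrow> real^'n) \<Rightarrow> real \<Rightarrow> ('m \<Rightarrow> real^'n \<Rightarrow> real) \<Rightarrow> (real \<Rightarrow> real^'n) \<Rightarrow> real \<Rightarrow> bool"
  where
  "assm_f f Lf g u T \<longleftrightarrow>
     Lf > 0 \<and>
     (\<forall>x1 x2 a1 a2. norm (f x1 a1 - f x2 a2) \<le> Lf * (norm (x1 - x2) + norm (a1 - a2))) \<and>
     (\<exists>M>0. \<forall>x \<in> (\<Union>t\<in>{0..T}. C_moved g (u t)). \<forall>a. norm (f x a) \<le> M * (1 + norm x))"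

definition active_set :: "('m \<Rightarrow> real^'n \<Rightarrow> real) \<Rightarrow> real \<Rightarrow> real^'n \<Rightarrow> 'm set" where
  "active_set g \<rho> x = {i. g i x \<le> \<rho>}"

text \<open>The norm of the Hessian is the operator norm of the Euclidean norm.\<close>

definition assm_g :: "('m::finite \<Rightarrow> real^'n \<Rightarrow> real) \<Rightarrow> bool" where
  "assm_g g \<longleftrightarrow>
     (\<forall>i. convex_on UNIV (g i) \<and> C2_fun (g i)) \<and>
     (\<exists>c>0. \<exists>M1>0. \<exists>M2>0. \<exists>M3>0. \<exists>V::'m \<Rightarrow> (real^'n) set. \<forall>i.
        open (V i) \<and> C_comp g i \<subseteq> V i \<and> Hausdorff_dist (C_comp g i) (UNIV - V i) > ennreal c \<and>
        (\<forall>x\<in>V i. M1 \<le> norm (grad (g i) x) \<and> norm (grad (g i) x) \<le> M2 \<and>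
                 onorm (\<lambda>h. hessian (g i) x *v h) \<le> M3)) \<and>
     (\<exists>\<beta>>0. \<exists>\<rho>>0. \<forall>x\<in>C_set g. \<forall>l::'m \<Rightarrow> real. (\<forall>i. 0 \<le> l i) \<longrightarrow>
        (\<Sum>i\<in>active_set g \<rho> x. l i * norm (grad (g i) x))
          \<le> \<beta> * norm (\<Sum>i\<in>active_set g \<rho> x. l i *\<^sub>R grad (g i) x))"

definition assm_nu :: "('s::finite \<Rightarrow> real^'n \<Rightarrow> real) \<Rightarrow> real \<Rightarrow> bool" where
  "assm_nu \<nu> L\<nu> \<longleftrightarrow>
     (\<forall>i. C1_fun (\<nu> i)) \<and>
     (\<forall>x. rank (jacobian (\<lambda>y. (\<chi> i. \<nu> i y) :: real^'s) (at x)) = min CARD('s) CARD('n)) \<and>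
     L\<nu> > 0 \<and>
     (\<forall>i u1 u2. \<bar>\<nu> i u2 - \<nu> i u1\<bar> \<le> L\<nu> * norm (u2 - u1)) \<and>
     (\<forall>i u. norm (grad (\<nu> i) u) \<le> L\<nu>) \<and>
     (\<forall>u\<in>U_set \<nu>. \<forall>v::'s \<Rightarrow> real^'n.
        (\<forall>i. v i \<in> normal_cone (U_comp \<nu> i) u) \<and> (\<Sum>i\<in>UNIV. v i) = 0 \<longrightarrow> (\<forall>i. v i = 0))"

definition assm_A :: "(real^'n \<Rightarrow> real^'d \<Rightarrow> real^'n) \<Rightarrow> (real^'d) set \<Rightarrow> bool" where
  "assm_A f A \<longleftrightarrow> A \<noteq> {} \<and> compact A \<and> (\<forall>x. convex (f x ` A))"

section \<open>Discretization\<close>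

definition step :: "real \<Rightarrow> nat \<Rightarrow> real" where
  "step T k = T / real k"

definition node :: "real \<Rightarrow> nat \<Rightarrow> nat \<Rightarrow> real" where
  "node T k j = real j * step T k"

definition piecewise_linear :: "real \<Rightarrow> nat \<Rightarrow> (real \<Rightarrow> 'a::real_vector) \<Rightarrow> bool" where
  "piecewise_linear T k y \<longleftrightarrow>
     (\<forall>j<k. \<exists>w. \<forall>t\<in>{node T k j..node T k (Suc j)}.
        y t = y (node T k j) + (t - node T k j) *\<^sub>R w)"

text \<open>The value at the final node \<open>T\<close> is separate.\<close>

definition piecewise_constant :: "real \<Rightarrow> nat \<Rightarrow> (real \<Rightarrow> 'a) \<Rightarrow> bool" where
  "piecewise_constant T k y \<longleftrightarrow>
     (\<forall>j<k. \<forall>t\<in>{node T k j..<node T k (Suc j)}. y t = y (node T k j))"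

definition mu_tilde :: "real \<Rightarrow> real \<Rightarrow> real \<Rightarrow> real" where
  "mu_tilde Lf T \<mu> =
     max (3 * \<mu> + 1 + 4 * Lf * T * \<mu> * exp (Lf * T) * (2 * Lf + 1) + 2 * Lf * \<mu>)
         (2 * exp (Lf * T) * (2 * Lf + 1) * (\<mu> + 1) + \<mu>)"

end

theory Submission
  imports Defs
begin

text \<open>
  The discrete controls are chosen so that \<open>x\<^sup>k - u\<^sup>k\<close> coincides with \<open>x - u\<close> at every node; the
  normal vectors of the continuous process can then be used unchanged in the discrete one. Since
  the inclusion for \<open>x\<close> holds only almost everywhere, its data at a node \<open>t\<^sub>j\<close> are cluster points
  \<open>(p\<^sub>j, b\<^sub>j)\<close> of \<open>(dx, a)\<close> from the right, and the closed graph of the normal cone gives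
  \<open>f (x t\<^sub>j) b\<^sub>j - p\<^sub>j \<in> N\<^sub>C (x t\<^sub>j - u t\<^sub>j)\<close>. With slopes \<open>v\<^sub>j = p\<^sub>j + f (x\<^sup>k\<^sub>j) b\<^sub>j - f (x t\<^sub>j) b\<^sub>j\<close> the inclusion holds
  exactly, and \<open>\<parallel>x\<^sup>k\<^sub>j - x t\<^sub>j\<parallel> = O(h\<^sub>k)\<close> by a discrete Gronwall inequality, because the oscillations of
  \<open>dx\<close> over the cells sum up to at most \<open>\<mu>\<close>. The same summability gives the convergence in \<open>L\<^sup>2\<close> and
  the bounds on the slopes of \<open>u\<^sup>k\<close>.
\<close>

section \<open>Absolutely continuous functions\<close>

text \<open>At the tags in the null set where \<open>y\<close> is not differentiable, the gauge confines the cells to an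
  open set of small measure, on which absolute continuity makes the increments of \<open>y\<close> small.\<close>

lemma abs_continuous_has_integral:
  fixes y :: "real \<Rightarrow> 'a::euclidean_space"
  assumes ac: "abs_continuous T y" and der: "is_derivative T y dy"
    and ab: "0 \<le> a" "a \<le> b" "b \<le> T"
  shows "(dy has_integral (y b - y a)) {a..b}"
proof -
  define N where "N = {t\<in>{0..T}. \<not> (y has_vector_derivative dy t) (at t within {0..T})}"
  have "AE t in lebesgue. t \<in> {0..T} \<longrightarrow> (y has_vector_derivative dy t) (at t within {0..T})"
    using der unfolding is_derivative_def by (subst (asm) AE_restrict_space_iff) auto
  then obtain M where M: "negligible M"
    "{t. \<not> (t \<in> {0..T} \<longrightarrow> (y has_vector_derivative dy t) (at t within {0..T}))} \<subseteq> M"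
    unfolding eventually_ae_filter_negligible by blast
  then have negN: "negligible N" using negligible_subset[OF M(1), of N] by (auto simp: N_def)
  then have N0: "N \<in> null_sets lebesgue" by (simp add: negligible_iff_null_sets)
  \<comment> \<open>Setting the derivative to zero on \<open>N\<close> removes the tags in
    \<open>N\<close> from the Riemann sums; the integral does not notice the change,
    \<open>N\<close> being negligible.\<close>
  define w where "w t = (if t \<in> N then 0 else dy t)" for t
  have "(w has_integral (y b - y a)) {a..b}"
    unfolding has_integral_real
  proof (intro allI impI)
    fix e :: real assume e: "e > 0"
    \<comment> \<open>Chosen so that the cells with good tags contribute at most
      \<open>e1 * (b - a) < e / 2\<close>; the summand 1 covers \<open>a = b\<close>.\<close>
    define e1 where "e1 = e / (2 * (b - a + 1))"
    have e1: "e1 > 0" using e ab by (simp add: e1_def)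
    have e1b: "e1 * (b - a) < e / 2"
      using e ab unfolding e1_def by (simp add: field_simps)
    have "e / 2 > 0" using e by simp
    from ac[unfolded abs_continuous_def, THEN spec, THEN mp, OF this]
    obtain \<delta> where \<delta>: "\<delta> > 0" and acd: "\<And>(M::nat) s t.
        (\<forall>i<M. 0 \<le> s i \<and> s i \<le> t i \<and> t i \<le> T) \<and>
        (\<forall>i<M. \<forall>j<M. i \<noteq> j \<longrightarrow> {s i<..<t i} \<inter> {s j<..<t j} = {}) \<and>
        (\<Sum>i<M. t i - s i) < \<delta> \<Longrightarrow> (\<Sum>i<M. norm (y (t i) - y (s i))) < e / 2"
      by (elim exE conjE) simp
    \<comment> \<open>Outer regularity of Lebesgue measure encloses the null set \<open>N\<close> in
      an open set whose measure lies below the \<delta> of absolute continuity.\<close>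
    obtain W where W: "open W" "N \<subseteq> W" "(W - N) \<in> lmeasurable" "emeasure lebesgue (W - N) < ennreal \<delta>"
      using sets_lebesgue_outer_open N0 \<delta> by blast
    have Wm: "emeasure lebesgue W < ennreal \<delta>"
      using W(4) N0 W(1) by (simp add: emeasure_Diff_null_set)
    have "\<forall>t. \<exists>d>0. t \<in> {0..T} - N \<longrightarrow>
       (\<forall>s\<in>{0..T}. norm (s - t) < d \<longrightarrow> norm (y s - y t - (s - t) *\<^sub>R dy t) \<le> e1 * norm (s - t))"
    proof
      fix t
      show "\<exists>d>0. t \<in> {0..T} - N \<longrightarrow>
       (\<forall>s\<in>{0..T}. norm (s - t) < d \<longrightarrow> norm (y s - y t - (s - t) *\<^sub>R dy t) \<le> e1 * norm (s - t))"
      proof (cases "t \<in> {0..T} - N")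
        case True
        then have "(y has_vector_derivative dy t) (at t within {0..T})" by (auto simp: N_def)
        then show ?thesis using e1 unfolding has_vector_derivative_def has_derivative_within_alt by blast
      qed (auto intro: exI[of _ 1])
    qed
    then obtain d where d: "\<And>t. 0 < d t"
      "\<And>t s. \<lbrakk>t \<in> {0..T} - N; s \<in> {0..T}; norm (s - t) < d t\<rbrakk>
         \<Longrightarrow> norm (y s - y t - (s - t) *\<^sub>R dy t) \<le> e1 * norm (s - t)"
      by metis
    define \<gamma> where "\<gamma> t = (if t \<in> N then W else ball t (d t))" for t
    have "gauge \<gamma>" using W d by (auto simp: gauge_def \<gamma>_def)
    moreover have "norm ((\<Sum>(t, K)\<in>p. measure lborel K *\<^sub>R w t) - (y b - y a)) < e"
      if p: "p tagged_division_of {a..b}" and fine: "\<gamma> fine p" for p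
    proof -
      have fin: "finite p" using p by blast
      have ba: "b - a = (\<Sum>(x,K)\<in>p. Sup K - Inf K)" "y b - y a = (\<Sum>(x,K)\<in>p. y(Sup K) - y(Inf K))"
        using additive_tagged_division_1[where f= "\<lambda>x. x"] additive_tagged_division_1[where f= y] ab p by auto
      have K: "\<exists>u v. K = {u..v} \<and> u \<le> t \<and> t \<le> v \<and> a \<le> u \<and> v \<le> b" if tK: "(t,K) \<in> p" for t K
      proof -
        have "t \<in> K" "K \<subseteq> {a..b}" using tagged_division_ofD(2,3)[OF p tK] by auto
        moreover obtain u v where "K = cbox u v" using tagged_division_ofD(4)[OF p tK] by blast
        ultimately show ?thesis by (intro exI[of _ u] exI[of _ v]) auto
      qed
      have le: "norm (measure lborel K *\<^sub>R w t - (y (Sup K) - y (Inf K))) \<le>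
           e1 * (Sup K - Inf K) + (if t \<in> N then norm (y (Sup K) - y (Inf K)) else 0)" if tK: "(t,K) \<in> p" for t K
      proof -
        obtain u v where uv: "K = {u..v}" "u \<le> t" "t \<le> v" "a \<le> u" "v \<le> b" using K tK by blast
        show ?thesis
        proof (cases "t \<in> N")
          case True
          then show ?thesis using uv e1 by (simp add: w_def norm_minus_commute)
        next
          case False
          have "K \<subseteq> ball t (d t)" using fineD[OF fine tK] False by (simp add: \<gamma>_def)
          moreover have "u \<in> K" "v \<in> K" using uv by auto
          ultimately have b: "u \<in> ball t (d t)" "v \<in> ball t (d t)" by blast+
          have 1: "norm (y u - y t - (u - t) *\<^sub>R dy t) \<le> e1 * norm (u - t)"
            using b uv ab False by (intro d(2)) (auto simp: dist_real_def)
          have 2: "norm (y v - y t - (v - t) *\<^sub>R dy t) \<le> e1 * norm (v - t)"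
            using b uv ab False by (intro d(2)) (auto simp: dist_real_def)
          \<comment> \<open>The tag lies between the endpoints, so the two linearization errors at
            \<open>t\<close> add up to exactly \<open>e1\<close> times the length of the
            cell.\<close>
          have "norm ((v - u) *\<^sub>R dy t - (y v - y u)) = norm (y u - y t - (u - t) *\<^sub>R dy t - (y v - y t - (v - t) *\<^sub>R dy t))"
            by (auto simp: algebra_simps)
          also have "\<dots> \<le> e1 * norm (u - t) + e1 * norm (v - t)"
            using 1 2 norm_triangle_ineq4[of "y u - y t - (u - t) *\<^sub>R dy t" "y v - y t - (v - t) *\<^sub>R dy t"] by linarith
          also have "\<dots> = e1 * (v - u)" using uv by (simp add: algebra_simps)
          finally show ?thesis using uv False by (simp add: w_def)
        qed
      qed
      \<comment> \<open>The cells with bad tags are enumerated by natural numbers because absolute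
        continuity speaks of finite indexed families of intervals.\<close>
      define q where "q = {(t,K)\<in>p. t \<in> N}"
      have finq: "finite q" and qp: "q \<subseteq> p" using fin by (auto simp: q_def intro: finite_subset)
      obtain \<phi> where \<phi>: "bij_betw \<phi> {0..<card q} q" using ex_bij_betw_nat_finite finq by blast
      define s where "s i = Inf (snd (\<phi> i))" for i
      define r where "r i = Sup (snd (\<phi> i))" for i
      have \<phi>q: "\<phi> i \<in> q" if "i < card q" for i using \<phi> that by (auto simp: bij_betw_def)
      have sr: "snd (\<phi> i) = {s i..r i} \<and> a \<le> s i \<and> s i \<le> r i \<and> r i \<le> b \<and> {s i..r i} \<subseteq> W" if "i < card q" for i
      proof -
        obtain t K where tK: "\<phi> i = (t,K)" by force
        then have "(t,K) \<in> p" "t \<in> N" using \<phi>q[OF that] by (auto simp: q_def)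
        moreover from this have "K \<subseteq> W" using fineD[OF fine] by (fastforce simp: \<gamma>_def)
        ultimately show ?thesis using K[of t K] tK by (auto simp: s_def r_def)
      qed
      have dis: "{s i<..<r i} \<inter> {s j<..<r j} = {}" if "i < card q" "j < card q" "i \<noteq> j" for i j
      proof -
        have "\<phi> i \<noteq> \<phi> j" using \<phi> that by (auto simp: bij_betw_def inj_on_def)
        then have "interior (snd (\<phi> i)) \<inter> interior (snd (\<phi> j)) = {}"
          using tagged_division_ofD(5)[OF p, of "fst (\<phi> i)" "snd (\<phi> i)" "fst (\<phi> j)" "snd (\<phi> j)"] \<phi>q that qp
          by (auto simp: prod_eq_iff)
        then show ?thesis using sr that by (simp add: interior_atLeastAtMost_real)
      qed
      \<comment> \<open>The open cells are disjoint and lie in \<open>W\<close>, so their total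
        length is at most the measure of \<open>W\<close>.\<close>
      have len: "(\<Sum>i<card q. r i - s i) < \<delta>"
      proof -
        have "ennreal (\<Sum>i<card q. r i - s i) = (\<Sum>i<card q. ennreal (r i - s i))"
          using sr by (subst sum_ennreal) auto
        also have "\<dots> = (\<Sum>i<card q. emeasure lebesgue {s i<..<r i})"
          using sr by (intro sum.cong) auto
        also have "\<dots> = emeasure lebesgue (\<Union>i<card q. {s i<..<r i})"
          using dis by (intro sum_emeasure) (auto simp: disjoint_family_on_def)
        also have "\<dots> \<le> emeasure lebesgue W"
        proof (intro emeasure_mono UN_least)
          fix i assume "i \<in> {..<card q}"
          then show "{s i<..<r i} \<subseteq> W" using sr[of i] by (meson greaterThanLessThan_subseteq_atLeastAtMost_iff lessThan_iff order.refl order_trans)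
        qed (use W in auto)
        also have "\<dots> < ennreal \<delta>" by (rule Wm)
        finally show ?thesis by (meson ennreal_leI not_le)
      qed
      have "(\<Sum>i<card q. norm (y (r i) - y (s i))) < e / 2"
      proof (rule acd, intro conjI)
        show "\<forall>i<card q. 0 \<le> s i \<and> s i \<le> r i \<and> r i \<le> T" using sr ab by fastforce
        show "\<forall>i<card q. \<forall>j<card q. i \<noteq> j \<longrightarrow> {s i<..<r i} \<inter> {s j<..<r j} = {}" using dis by blast
      qed (rule len)
      also have "(\<Sum>i<card q. norm (y (r i) - y (s i))) = (\<Sum>(t,K)\<in>q. norm (y (Sup K) - y (Inf K)))"
        using sum.reindex_bij_betw[OF \<phi>, of "\<lambda>(t,K). norm (y (Sup K) - y (Inf K))"]
        by (simp add: s_def r_def case_prod_beta atLeast0LessThan)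
      also have "\<dots> = (\<Sum>(t,K)\<in>p. if t \<in> N then norm (y (Sup K) - y (Inf K)) else 0)"
        unfolding q_def using fin by (subst sum.mono_neutral_cong_left[of p]) (auto split: if_splits)
      finally have bad: "(\<Sum>(t,K)\<in>p. if t \<in> N then norm (y (Sup K) - y (Inf K)) else 0) < e / 2" .
      have "norm ((\<Sum>(t, K)\<in>p. measure lborel K *\<^sub>R w t) - (y b - y a))
          = norm (\<Sum>(t, K)\<in>p. measure lborel K *\<^sub>R w t - (y (Sup K) - y (Inf K)))"
        by (simp add: ba(2) split_def sum_subtractf)
      also have "\<dots> \<le> (\<Sum>(t,K)\<in>p. e1 * (Sup K - Inf K) + (if t \<in> N then norm (y (Sup K) - y (Inf K)) else 0))"
        by (rule sum_norm_le) (use le in auto)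
      also have "\<dots> = e1 * (b - a) + (\<Sum>(t,K)\<in>p. if t \<in> N then norm (y (Sup K) - y (Inf K)) else 0)"
        unfolding ba(1) by (simp add: split_def sum.distrib sum_distrib_left)
      also have "\<dots> < e" using bad e1b by simp
      finally show ?thesis .
    qed
    ultimately show "\<exists>\<gamma>. gauge \<gamma> \<and> (\<forall>p. p tagged_division_of {a..b} \<and> \<gamma> fine p \<longrightarrow>
         norm ((\<Sum>(t, K)\<in>p. measure lborel K *\<^sub>R w t) - (y b - y a)) < e)"
      by (intro exI[of _ \<gamma>]) simp
  qed
  then show ?thesis
    by (rule has_integral_spike[OF negN, rotated]) (auto simp: w_def)
qed

text \<open>By the fundamental theorem above, \<open>y\<close> is its initial value plus an
  indefinite integral of \<open>dy\<close>, and indefinite integrals are continuous.\<close>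

lemma abs_continuous_imp_continuous_on:
  fixes y :: "real \<Rightarrow> 'a::euclidean_space"
  assumes "abs_continuous T y" and "is_derivative T y dy"
  shows "continuous_on {0..T} y"
proof (cases "0 \<le> T")
  case True
  have h: "(dy has_integral (y b - y 0)) {0..b}" if "0 \<le> b" "b \<le> T" for b
    using abs_continuous_has_integral[OF assms] that by simp
  have "continuous_on {0..T} (\<lambda>b. y 0 + integral {0..b} dy)"
    using h[of T] True by (intro continuous_intros indefinite_integral_continuous_1) auto
  then show ?thesis
    by (rule continuous_on_eq) (use h in \<open>force simp: integral_unique\<close>)
qed simp

text \<open>Mean value inequality relative to a reference slope: integrate \<open>dy - q\<close>
  over the interval.\<close>

lemma diff_near_slope:
  fixes y :: "real \<Rightarrow> 'a::euclidean_space"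
  assumes "abs_continuous T y" and "is_derivative T y dy" and ab: "0 \<le> a" "a \<le> b" "b \<le> T"
    and W: "\<And>t. t \<in> {a..b} \<Longrightarrow> norm (dy t - q) \<le> W"
  shows "norm (y b - y a - (b - a) *\<^sub>R q) \<le> W * (b - a)"
proof -
  have "((\<lambda>t. dy t - q) has_integral (y b - y a - (b - a) *\<^sub>R q)) {a..b}"
    using has_integral_diff[OF abs_continuous_has_integral[OF assms(1-5)] has_integral_const_real[of q a b]] ab by simp
  moreover have "0 \<le> W" using W[of a] ab norm_ge_zero[of "dy a - q"] by (auto intro: order_trans simp del: norm_ge_zero)
  ultimately show ?thesis
    using has_integral_bound[of W "\<lambda>t. dy t - q" _ a b] W ab by simp
qed

lemma diff_quotient_near:
  fixes y :: "real \<Rightarrow> 'a::euclidean_space"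
  assumes "abs_continuous T y" and "is_derivative T y dy" and ab: "0 \<le> a" "a < b" "b \<le> T"
    and W: "\<And>t. t \<in> {a..b} \<Longrightarrow> norm (dy t - q) \<le> W"
  shows "norm ((y b - y a) /\<^sub>R (b - a) - q) \<le> W"
proof -
  have "(y b - y a) /\<^sub>R (b - a) - q = (y b - y a - (b - a) *\<^sub>R q) /\<^sub>R (b - a)"
    using ab by (simp add: scaleR_diff_right)
  then have "norm ((y b - y a) /\<^sub>R (b - a) - q) = norm (y b - y a - (b - a) *\<^sub>R q) / (b - a)"
    using ab by (simp add: divide_inverse mult.commute)
  also have "\<dots> \<le> W"
    using diff_near_slope[OF assms(1,2), of a b q W] ab W by (simp add: divide_le_eq)
  finally show ?thesis .
qed

section \<open>Total variation\<close>

lemma sum_le_total_variation: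
  fixes y :: "real \<Rightarrow> 'a::real_normed_vector"
  assumes tv: "total_variation y a b \<le> ennreal \<mu>" "0 \<le> \<mu>"
    and p: "\<And>i. i \<le> N \<Longrightarrow> p i \<in> {a..b}" "\<And>i. i < N \<Longrightarrow> p i \<le> p (Suc i)"
  shows "(\<Sum>i<N. norm (y (p (Suc i)) - y (p i))) \<le> \<mu>"
proof -
  have "(\<Sum>i<N. ennreal (norm (y (p (Suc i)) - y (p i)))) \<le> total_variation y a b"
    unfolding total_variation_def
    by (rule SUP_upper2[of "(N, p)"]) (use p in auto)
  then have "ennreal (\<Sum>i<N. norm (y (p (Suc i)) - y (p i))) \<le> ennreal \<mu>"
    using tv(1) by (simp add: order_trans)
  then show ?thesis using tv(2) by simp
qed

lemma norm_diff_le_total_variation: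
  fixes y :: "real \<Rightarrow> 'a::real_normed_vector"
  assumes tv: "total_variation y a b \<le> ennreal \<mu>" "0 \<le> \<mu>"
  shows "s \<in> {a..b} \<Longrightarrow> t \<in> {a..b} \<Longrightarrow> norm (y s - y t) \<le> \<mu>"
proof (induction s t rule: linorder_wlog)
  case (le s t)
  then show ?case
    using sum_le_total_variation[OF tv, of 1 "\<lambda>i. if i = 0 then s else t"]
    by (simp add: norm_minus_commute)
qed (simp add: norm_minus_commute)

text \<open>Near-extremal pairs of points of the successive cells interleave to a single partition.\<close>

lemma variation_oscillation:
  fixes y :: "real \<Rightarrow> 'a::real_normed_vector"
  assumes tv: "total_variation y a b \<le> ennreal \<mu>" "0 \<le> \<mu>"
    and mono: "\<forall>j<k. q j \<le> q (Suc j)" and range: "\<forall>j\<le>k. q j \<in> {a..b}"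
  shows "\<exists>V. (\<forall>j. 0 \<le> V j) \<and>
    (\<forall>j<k. \<forall>s\<in>{q j..q (Suc j)}. \<forall>t\<in>{q j..q (Suc j)}. norm (y s - y t) \<le> V j) \<and>
    (\<Sum>j<k. V j) \<le> \<mu>"
proof -
  have q: "q i \<le> q (Suc i)" if "i < k" for i using mono that by blast
  have q2: "q i \<in> {a..b}" if "i \<le> k" for i using range that by blast
  \<comment> \<open>Intersecting with \<open>{a..b}\<close> keeps \<open>S j\<close> bounded also
    for \<open>j \<ge> k\<close>, where the position of \<open>q j\<close> is unknown; thus
    \<open>V\<close> is nonnegative at every index.\<close>
  define S where "S j = y ` ({q j..q (Suc j)} \<inter> {a..b})" for j
  define V where "V j = diameter (S j)" for j
  have bS: "bounded (S j)" for j
  proof -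
    have "S j \<subseteq> cball (y a) \<mu>"
      using norm_diff_le_total_variation[OF tv, of a] by (auto simp: S_def dist_norm)
    then show ?thesis by (rule bounded_subset[OF bounded_cball])
  qed
  have pairs: "(\<Sum>j<k. norm (y (\<sigma> j) - y (\<tau> j))) \<le> \<mu>"
    if st: "\<And>j. j < k \<Longrightarrow> \<sigma> j \<in> {q j..q (Suc j)}" "\<And>j. j < k \<Longrightarrow> \<tau> j \<in> {q j..q (Suc j)}" for \<sigma> \<tau>
  proof -
    \<comment> \<open>The entries with indices \<open>2 * j\<close> and \<open>2 * j + 1\<close> are
      the two points of cell \<open>j\<close> in increasing order. The even increments form the
      wanted sum, the odd ones are dropped. The last of the \<open>2 * k\<close> increments needs an
      endpoint, which is \<open>q k\<close>.\<close>
    define p where "p i = (if i = 2 * k then q k else if even i then min (\<sigma> (i div 2)) (\<tau> (i div 2))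
       else max (\<sigma> (i div 2)) (\<tau> (i div 2)))" for i
    have p1: "p i \<in> {a..b}" if "i \<le> 2 * k" for i
    proof (cases "i = 2 * k")
      case False
      then have "i div 2 < k" using that by auto
      then show ?thesis using st[of "i div 2"] q2[of "i div 2"] q2[of "Suc (i div 2)"]
        by (auto simp: p_def min_def max_def)
    qed (use q2[of k] in \<open>simp add: p_def\<close>)
    have p2: "p i \<le> p (Suc i)" if i: "i < 2 * k" for i
    proof (cases "even i")
      case True
      then have "Suc i \<noteq> 2 * k" "Suc i div 2 = i div 2" by presburger+
      then show ?thesis using i True by (simp add: p_def)
    next
      case False
      then have *: "Suc i div 2 = Suc (i div 2)" "i div 2 < k" using i by presburger+
      have "p i \<le> q (Suc (i div 2))" using False i st[of "i div 2"] * by (auto simp: p_def)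
      also have "\<dots> \<le> p (Suc i)"
      proof (cases "Suc i = 2 * k")
        case True
        then have "Suc (i div 2) = k" using False by presburger
        then show ?thesis using True by (simp add: p_def)
      next
        case False2: False
        then have "Suc (i div 2) < k" using i False by presburger
        then show ?thesis using False False2 st[of "Suc (i div 2)"] * by (auto simp: p_def)
      qed
      finally show ?thesis .
    qed
    have dbl: "(\<Sum>i<2 * m. F i) = (\<Sum>j<m. F (2 * j) + F (2 * j + 1))" for F :: "nat \<Rightarrow> real" and m
      by (induction m) auto
    have "(\<Sum>j<k. norm (y (\<sigma> j) - y (\<tau> j))) \<le> (\<Sum>i<2 * k. norm (y (p (Suc i)) - y (p i)))"
      unfolding dbl
    proof (rule sum_mono)
      fix j assume "j \<in> {..<k}"
      then have "j < k" by simp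
      then have "2 * j \<noteq> 2 * k" "Suc (2 * j) \<noteq> 2 * k" by presburger+
      then have "norm (y (p (Suc (2 * j))) - y (p (2 * j))) = norm (y (\<sigma> j) - y (\<tau> j))"
        by (auto simp: p_def min_def max_def norm_minus_commute)
      then show "norm (y (\<sigma> j) - y (\<tau> j)) \<le> norm (y (p (Suc (2 * j))) - y (p (2 * j))) + norm (y (p (Suc (2 * j + 1))) - y (p (2 * j + 1)))"
        by simp
    qed
    also have "\<dots> \<le> \<mu>" using p1 p2 by (intro sum_le_total_variation[OF tv]) auto
    finally show ?thesis .
  qed
  show ?thesis
  proof (intro exI[of _ V] conjI allI impI ballI)
    show "0 \<le> V j" for j unfolding V_def by (rule diameter_ge_0[OF bS])
    show "norm (y s - y t) \<le> V j" if "j < k" "s \<in> {q j..q (Suc j)}" "t \<in> {q j..q (Suc j)}" for j s t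
      using diameter_bounded_bound[OF bS, of "y s" j "y t"] that q2[of j] q2[of "Suc j"]
      by (auto simp: V_def S_def dist_norm)
    show "(\<Sum>j<k. V j) \<le> \<mu>"
    proof (rule field_le_epsilon)
      fix e :: real assume e: "e > 0"
      \<comment> \<open>The loss \<epsilon> in each of the \<open>k\<close> cells adds up to at most
        \<open>e\<close>.\<close>
      define \<epsilon> where "\<epsilon> = e / (real k + 1)"
      have eps: "\<epsilon> > 0" "real k * \<epsilon> \<le> e" using e by (auto simp: \<epsilon>_def field_simps)
      \<comment> \<open>If \<open>V j\<close> is at most \<epsilon>, the lower bound is not positive
        and the pair of equal points \<open>q j\<close> satisfies it; otherwise the definition of
        the diameter supplies a pair.\<close>
      have "\<exists>s t. j < k \<longrightarrow> s \<in> {q j..q (Suc j)} \<and> t \<in> {q j..q (Suc j)} \<and> V j - \<epsilon> \<le> norm (y s - y t)" for j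
      proof (cases "j < k \<and> 0 < V j - \<epsilon>")
        case True
        then show ?thesis
          using diameter_lower_bounded[OF bS, of "V j - \<epsilon>" j] eps
          unfolding V_def S_def by (fastforce simp: dist_norm)
      next
        case False
        then show ?thesis using q[of j] by (intro exI[of _ "q j"]) auto
      qed
      then obtain \<sigma> \<tau> where st: "\<And>j. j < k \<Longrightarrow> \<sigma> j \<in> {q j..q (Suc j)}" "\<And>j. j < k \<Longrightarrow> \<tau> j \<in> {q j..q (Suc j)}"
        "\<And>j. j < k \<Longrightarrow> V j - \<epsilon> \<le> norm (y (\<sigma> j) - y (\<tau> j))" by metis
      have "(\<Sum>j<k. V j) - real k * \<epsilon> = (\<Sum>j<k. V j - \<epsilon>)" by (simp add: sum_subtractf)
      also have "\<dots> \<le> (\<Sum>j<k. norm (y (\<sigma> j) - y (\<tau> j)))" by (rule sum_mono) (use st(3) in auto)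
      also have "\<dots> \<le> \<mu>" by (rule pairs) (use st in auto)
      finally show "(\<Sum>j<k. V j) \<le> \<mu> + e" using eps by simp
    qed
  qed
qed

text \<open>Both increments are integrals of \<open>du\<close> over cells of equal length, so their difference is
  the integral of a translated difference of \<open>du\<close>, and the variation bound applies pointwise.\<close>

lemma sum_second_differences_le:
  fixes u :: "real \<Rightarrow> 'a::euclidean_space"
  assumes ac: "abs_continuous T u" and der: "is_derivative T u du"
    and tv: "total_variation du 0 T \<le> ennreal \<mu>" "0 \<le> \<mu>" and h: "0 \<le> h" "real (Suc m) * h \<le> T"
  defines "D \<equiv> \<lambda>j. u (real (Suc j) * h) - u (real j * h)"
  shows "(\<Sum>j<m. norm (D (Suc j) - D j)) \<le> h * \<mu>"
proof -
  have le: "real j * h \<le> T" if "j \<le> Suc m" for j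
    using mult_right_mono[of "real j" "real (Suc m)" h] that h by auto
  have int: "((\<lambda>s. du (s + real j * h)) has_integral D j) {0..h}" if "j \<le> m" for j
  proof -
    have "(du has_integral D j) {real j * h..real (Suc j) * h}"
      unfolding D_def using h le[of "Suc j"] that
      by (intro abs_continuous_has_integral[OF ac der]) (auto simp: mult_right_mono)
    from has_integral_shift_real_ivl[OF this, of "real j * h"] show ?thesis
      by (simp add: algebra_simps)
  qed
  \<comment> \<open>Pairing each second difference with its own direction, a vector independent of
    \<open>s\<close>, turns the sum of norms into the integral of a single real function.\<close>
  have "((\<lambda>s. \<Sum>j<m. (du (s + real (Suc j) * h) - du (s + real j * h)) \<bullet> sgn (D (Suc j) - D j))
      has_integral (\<Sum>j<m. (D (Suc j) - D j) \<bullet> sgn (D (Suc j) - D j))) {0..h}"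
  proof (rule has_integral_sum)
    fix j assume "j \<in> {..<m}"
    then show "((\<lambda>s. (du (s + real (Suc j) * h) - du (s + real j * h)) \<bullet> sgn (D (Suc j) - D j))
      has_integral ((D (Suc j) - D j) \<bullet> sgn (D (Suc j) - D j))) {0..h}"
      using has_integral_linear[OF has_integral_diff[OF int[of "Suc j"] int[of j]]
         bounded_linear_inner_left[of "sgn (D (Suc j) - D j)"]] by (simp add: o_def)
  qed simp
  moreover have "((\<lambda>s. \<mu>) has_integral \<mu> * h) {0..h}"
    using has_integral_const_real[of \<mu> 0 h] h by (simp add: mult.commute)
  ultimately have "(\<Sum>j<m. (D (Suc j) - D j) \<bullet> sgn (D (Suc j) - D j)) \<le> \<mu> * h"
  proof (rule has_integral_le)
    fix s assume s: "s \<in> {0..h}"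
    have "(\<Sum>j<m. (du (s + real (Suc j) * h) - du (s + real j * h)) \<bullet> sgn (D (Suc j) - D j))
       \<le> (\<Sum>j<m. norm (du (s + real (Suc j) * h) - du (s + real j * h)))"
    proof (rule sum_mono)
      fix j
      show "(du (s + real (Suc j) * h) - du (s + real j * h)) \<bullet> sgn (D (Suc j) - D j)
         \<le> norm (du (s + real (Suc j) * h) - du (s + real j * h))"
        by (rule order_trans[OF norm_cauchy_schwarz]) (simp add: norm_sgn)
    qed
    also have "\<dots> \<le> \<mu>"
    \<comment> \<open>For a fixed offset \<open>s\<close> in the first cell, the translated points
      \<open>s + j * h\<close> with \<open>j \<le> m\<close> form a partition inside
      \<open>{0..T}\<close>.\<close>
    proof (rule sum_le_total_variation[OF tv, of m "\<lambda>j. s + real j * h"])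
      fix j assume "j \<le> m"
      then show "s + real j * h \<in> {0..T}" using s h le[of "Suc j"] by (auto simp: algebra_simps)
    qed (use h in \<open>auto simp: algebra_simps\<close>)
    finally show "(\<Sum>j<m. (du (s + real (Suc j) * h) - du (s + real j * h)) \<bullet> sgn (D (Suc j) - D j)) \<le> \<mu>" .
  qed
  moreover have "v \<bullet> sgn v = norm v" for v :: 'a
    by (cases "v = 0") (simp_all add: sgn_div_norm power2_norm_eq_inner[symmetric] power2_eq_square)
  ultimately show ?thesis by (simp add: mult.commute)
qed

section \<open>Normal vectors at one-sided limits\<close>

text \<open>Diagonal argument: from the sequence that witnesses each \<open>v n\<close>, one member
  is taken whose base point and scaled difference are within \<open>1 / Suc n\<close> of
  \<open>y n\<close> and \<open>v n\<close>. These members witness the limit.\<close>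

lemma normal_cone_closed_graph:
  fixes S :: "'a::euclidean_space set"
  assumes y: "y \<longlonglongrightarrow> z" and "z \<in> S" and v: "v \<longlonglongrightarrow> l" and n: "\<And>n::nat. v n \<in> normal_cone S (y n)"
  shows "l \<in> normal_cone S z"
proof -
  have ex: "\<exists>p w \<alpha>. dist p (y n) < 1 / Suc n \<and> w \<in> proj_set p S \<and> 0 \<le> \<alpha> \<and> dist (\<alpha> *\<^sub>R (p - w)) (v n) < 1 / Suc n" for n
  proof -
    from n[of n] obtain xs ws and \<alpha> :: "nat \<Rightarrow> real" where
      1: "xs \<longlonglongrightarrow> y n" "\<forall>k. ws k \<in> proj_set (xs k) S" "\<forall>k. 0 \<le> \<alpha> k" "(\<lambda>k. \<alpha> k *\<^sub>R (xs k - ws k)) \<longlonglongrightarrow> v n"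
      unfolding normal_cone_def by (auto split: if_splits)
    have "\<forall>\<^sub>F k in sequentially. dist (xs k) (y n) < 1 / Suc n \<and> dist (\<alpha> k *\<^sub>R (xs k - ws k)) (v n) < 1 / Suc n"
      using 1(1) 1(4) by (intro eventually_conj tendstoD) auto
    then obtain k where "dist (xs k) (y n) < 1 / Suc n \<and> dist (\<alpha> k *\<^sub>R (xs k - ws k)) (v n) < 1 / Suc n"
      using eventually_happens' sequentially_bot by blast
    then show ?thesis using 1 by blast
  qed
  then obtain p w \<alpha> where pw: "\<And>n. dist (p n) (y n) < 1 / Suc n" "\<And>n. w n \<in> proj_set (p n) S"
    "\<And>n. 0 \<le> \<alpha> n" "\<And>n. dist (\<alpha> n *\<^sub>R (p n - w n)) (v n) < 1 / Suc n" by metis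
  have lim: "a \<longlonglongrightarrow> c" if "b \<longlonglongrightarrow> c" "\<And>n. dist (a n) (b n) < 1 / Suc n" for a b :: "nat \<Rightarrow> 'a" and c
  proof -
    have "(\<lambda>n. dist (a n) (b n)) \<longlonglongrightarrow> 0"
      by (rule tendsto_sandwich[OF _ _ tendsto_const LIMSEQ_inverse_real_of_nat])
         (use that(2) in \<open>auto intro!: always_eventually less_imp_le simp: inverse_eq_divide\<close>)
    then have "(\<lambda>n. a n - b n) \<longlonglongrightarrow> 0"
      by (simp add: dist_norm tendsto_norm_zero_iff)
    from tendsto_add[OF this that(1)] show ?thesis by simp
  qed
  have "p \<longlonglongrightarrow> z" "(\<lambda>n. \<alpha> n *\<^sub>R (p n - w n)) \<longlonglongrightarrow> l"
    by (rule lim[OF y pw(1)], rule lim[OF v pw(4)])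
  then show ?thesis unfolding normal_cone_def using pw \<open>z \<in> S\<close> by auto
qed

text \<open>A null set contains no interval, so times at which the inclusion holds accumulate at
  \<open>t\<close> from the right. Compactness yields limits of \<open>dx\<close> and
  \<open>a\<close> along them, and the closed graph of the normal cone passes the inclusion to these
  limits.\<close>

lemma right_limit_in_normal_cone:
  fixes x u dx :: "real \<Rightarrow> real^'n" and a :: "real \<Rightarrow> real^'d"
  assumes t: "0 \<le> t" "t < T"
    and inc: "AE t in lebesgue_on {0..T}. f (x t) (a t) - dx t \<in> normal_cone S (x t - u t) \<and> a t \<in> A"
    and S: "closed S" and cont: "continuous_on {0..T} x" "continuous_on {0..T} u"
    and bdd: "bounded (dx ` {0..T})" and A: "compact A"
    and f: "continuous_on UNIV (\<lambda>(x, a). f x a)"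
  obtains s p b where "\<And>n::nat. s n \<in> {t<..<T}" "s \<longlonglongrightarrow> t"
    "(\<lambda>n. dx (s n)) \<longlonglongrightarrow> p" "(\<lambda>n. a (s n)) \<longlonglongrightarrow> b" "b \<in> A"
    "f (x t) b - p \<in> normal_cone S (x t - u t)"
proof -
  let ?P = "\<lambda>t. f (x t) (a t) - dx t \<in> normal_cone S (x t - u t) \<and> a t \<in> A"
  have "AE t in lebesgue. t \<in> {0..T} \<longrightarrow> ?P t"
    using inc by (subst (asm) AE_restrict_space_iff) auto
  then obtain M where M: "negligible M" "{t. \<not> (t \<in> {0..T} \<longrightarrow> ?P t)} \<subseteq> M"
    unfolding eventually_ae_filter_negligible by blast
  have "\<exists>s. s \<in> {t<..<T} \<and> s < t + 1 / Suc n \<and> ?P s" for n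
  proof -
    have "\<not> {t<..<min T (t + 1 / Suc n)} \<subseteq> M"
    proof
      assume "{t<..<min T (t + 1 / Suc n)} \<subseteq> M"
      then have "negligible {t<..<min T (t + 1 / Suc n)}" by (rule negligible_subset[OF M(1)])
      moreover have "{t<..<min T (t + 1 / Suc n)} \<noteq> {}" using t by (simp add: min_le_iff_disj not_le)
      ultimately show False using open_not_negligible[OF open_greaterThanLessThan] by blast
    qed
    then obtain s where s: "s \<in> {t<..<min T (t + 1 / Suc n)}" "s \<notin> M" by blast
    then have "s \<in> {0..T}" using t by simp
    then have "?P s" using M(2) s(2) by blast
    then show ?thesis using s(1) by auto
  qed
  then obtain s where s: "\<And>n. s n \<in> {t<..<T}" "\<And>n. s n < t + 1 / Suc n" "\<And>n. ?P (s n)" by metis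
  have "(\<lambda>n. t + 1 / Suc n) \<longlonglongrightarrow> t + 0"
    using LIMSEQ_inverse_real_of_nat by (intro tendsto_intros) (simp add: inverse_eq_divide)
  then have st: "s \<longlonglongrightarrow> t"
    by (intro tendsto_sandwich[OF _ _ tendsto_const, of t s])
       (use s in \<open>auto intro!: always_eventually less_imp_le\<close>)
  obtain B where B: "\<And>r. r \<in> {0..T} \<Longrightarrow> norm (dx r) \<le> B" using bdd unfolding bounded_iff by blast
  \<comment> \<open>Compactness of the product gives one subsequence along which \<open>dx\<close>
    and \<open>a\<close> converge together.\<close>
  have "compact (cball (0 :: real^'n) B \<times> A)" using A by (intro compact_Times compact_cball)
  moreover have "\<forall>n. (dx (s n), a (s n)) \<in> cball (0 :: real^'n) B \<times> A"
  proof
    fix n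
    have "s n \<in> {0..T}" using s(1)[of n] t by simp
    then show "(dx (s n), a (s n)) \<in> cball (0 :: real^'n) B \<times> A" using B s(3)[of n] by simp
  qed
  ultimately obtain l r where l: "l \<in> cball (0 :: real^'n) B \<times> A" "strict_mono (r::nat \<Rightarrow> nat)"
    "((\<lambda>n. (dx (s n), a (s n))) \<circ> r) \<longlonglongrightarrow> l"
    unfolding compact_def by meson
  have sr: "(\<lambda>n. s (r n)) \<longlonglongrightarrow> t" using LIMSEQ_subseq_LIMSEQ[OF st l(2)] by (simp add: o_def)
  have lim1: "(\<lambda>n. dx (s (r n))) \<longlonglongrightarrow> fst l" using tendsto_fst[OF l(3)] by (simp add: o_def)
  have lim2: "(\<lambda>n. a (s (r n))) \<longlonglongrightarrow> snd l" using tendsto_snd[OF l(3)] by (simp add: o_def)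
  have limc: "(\<lambda>n. w (s (r n))) \<longlonglongrightarrow> w t" if "continuous_on {0..T} w" for w :: "real \<Rightarrow> real^'n"
  proof (rule continuous_on_tendsto_compose[OF that sr])
    show "\<forall>\<^sub>F n in sequentially. s (r n) \<in> {0..T}"
      using s(1) t by (intro always_eventually allI) (meson atLeastAtMost_iff greaterThanLessThan_iff less_imp_le order_trans)
  qed (use t in simp)
  have limf: "(\<lambda>n. f (x (s (r n))) (a (s (r n)))) \<longlonglongrightarrow> f (x t) (snd l)"
    using continuous_on_tendsto_compose[OF f tendsto_Pair[OF limc[OF cont(1)] lim2]] by simp
  have limy: "(\<lambda>n. x (s (r n)) - u (s (r n))) \<longlonglongrightarrow> x t - u t"
    by (intro tendsto_diff limc cont)
  \<comment> \<open>The normal cone is empty off \<open>S\<close>, so the inclusion itself places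
    the points in \<open>S\<close>.\<close>
  have inS: "x (s n) - u (s n) \<in> S" for n
    using s(3)[of n] by (auto simp: normal_cone_def split: if_splits)
  have "x t - u t \<in> S"
    by (rule closed_sequentially[OF S inS limy])
  then have "f (x t) (snd l) - fst l \<in> normal_cone S (x t - u t)"
    using s(3) by (intro normal_cone_closed_graph[OF limy _ tendsto_diff[OF limf lim1]]) auto
  then show thesis using that[of "\<lambda>n. s (r n)" "fst l" "snd l"] s(1) sr lim1 lim2 l(1) by auto
qed

section \<open>Functions on a uniform mesh\<close>

text \<open>The minimum assigns the final node \<open>T\<close> to the last cell.\<close>

definition mesh_index :: "real \<Rightarrow> nat \<Rightarrow> real \<Rightarrow> nat" where
  "mesh_index T k t = min (nat \<lfloor>t / step T k\<rfloor>) (k - 1)"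

definition mesh_linear :: "real \<Rightarrow> nat \<Rightarrow> (nat \<Rightarrow> 'a::real_vector) \<Rightarrow> real \<Rightarrow> 'a" where
  "mesh_linear T k X t =
     (let j = mesh_index T k t
      in X j + ((t - node T k j) / step T k) *\<^sub>R (X (Suc j) - X j))"

lemma step_pos: "0 < T \<Longrightarrow> 1 \<le> k \<Longrightarrow> 0 < step T k"
  by (simp add: step_def)

lemma node_0 [simp]: "node T k 0 = 0"
  by (simp add: node_def)

lemma node_last: "1 \<le> k \<Longrightarrow> node T k k = T"
  by (simp add: node_def step_def)

lemma node_Suc: "node T k (Suc j) = node T k j + step T k"
  by (simp add: node_def algebra_simps)

lemma node_mono: "0 < T \<Longrightarrow> i \<le> j \<Longrightarrow> node T k i \<le> node T k j"
  by (simp add: node_def step_def mult_right_mono divide_right_mono)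

lemma node_in_interval: "0 < T \<Longrightarrow> 1 \<le> k \<Longrightarrow> j \<le> k \<Longrightarrow> node T k j \<in> {0..T}"
  using node_mono[of T 0 j k] node_mono[of T j k k] by (simp add: node_last)

lemma mesh_index_eq:
  assumes "0 < T" "j < k" "t \<in> {node T k j..<node T k (Suc j)}"
  shows "mesh_index T k t = j"
proof -
  have s: "0 < step T k" using assms by (simp add: step_pos)
  have "\<lfloor>t / step T k\<rfloor> = int j"
    using assms(3) s by (intro floor_unique) (auto simp: node_def field_simps)
  then show ?thesis using assms(2) by (simp add: mesh_index_def)
qed

lemma mesh_index_last: "0 < T \<Longrightarrow> 1 \<le> k \<Longrightarrow> mesh_index T k T = k - 1"
  by (simp add: mesh_index_def step_def)

lemma mesh_index_less: "1 \<le> k \<Longrightarrow> mesh_index T k t < k"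
  by (auto simp: mesh_index_def min_def)

lemma mesh_index_mono: "0 < T \<Longrightarrow> s \<le> t \<Longrightarrow> mesh_index T k s \<le> mesh_index T k t"
  unfolding mesh_index_def step_def
  by (intro min.mono nat_mono floor_mono divide_right_mono) auto

lemma mesh_index_bounds:
  assumes "0 < T" "1 \<le> k" "t \<in> {0..T}"
  shows "t \<in> {node T k (mesh_index T k t)..node T k (Suc (mesh_index T k t))}"
proof (cases "t = T")
  case True
  then show ?thesis using assms mesh_index_last[of T k] node_last[of k T] node_mono[of T "k - 1" k k] by simp
next
  case False
  define j where "j = nat \<lfloor>t / step T k\<rfloor>"
  have s: "0 < step T k" using assms by (simp add: step_pos)
  have j: "real j \<le> t / step T k" "t / step T k < real j + 1"
    unfolding j_def using assms s by (auto simp: of_nat_nat)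
  have "t / step T k < real k" using assms False s by (simp add: step_def field_simps)
  then have "j < k" using j by linarith
  moreover have "t \<in> {node T k j..<node T k (Suc j)}"
    using j s by (auto simp: node_def field_simps)
  ultimately show ?thesis using mesh_index_eq[OF assms(1)] by auto
qed

text \<open>The formula of a cell extends to its right endpoint: there the next cell takes over with
  the same node value, or the cell is the last one and owns \<open>T\<close>.\<close>

lemma mesh_linear_eq:
  assumes "0 < T" "j < k" "t \<in> {node T k j..node T k (Suc j)}"
  shows "mesh_linear T k X t = X j + ((t - node T k j) / step T k) *\<^sub>R (X (Suc j) - X j)"
proof (cases "t = node T k (Suc j)")
  case True
  have s: "0 < step T k" using assms by (simp add: step_pos)
  show ?thesis
  proof (cases "Suc j < k")
    case Suc: True
    have "mesh_index T k t = Suc j"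
      using True s by (intro mesh_index_eq[OF assms(1) Suc]) (auto simp: node_Suc[of _ _ "Suc j"])
    then show ?thesis using True s by (simp add: mesh_linear_def node_Suc)
  next
    case False
    then have "Suc j = k" using assms by simp
    then have "mesh_index T k t = j" using True mesh_index_last[OF assms(1), of k] node_last[of k T] by auto
    then show ?thesis by (simp add: mesh_linear_def)
  qed
next
  case False
  then have "mesh_index T k t = j" using assms by (intro mesh_index_eq) auto
  then show ?thesis by (simp add: mesh_linear_def)
qed

lemma mesh_linear_node:
  assumes "0 < T" "1 \<le> k" "j \<le> k"
  shows "mesh_linear T k X (node T k j) = X j"
proof (cases "j < k")
  case True
  then show ?thesis using mesh_linear_eq[of T j k "node T k j" X] node_mono[of T j "Suc j" k] assms by simp
next
  case False
  then have jk: "j = k" using assms by simp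
  obtain i where i: "k = Suc i" using assms(2) by (cases k) auto
  show ?thesis
    using mesh_linear_eq[of T i k "node T k k" X] node_mono[of T i k k] step_pos[of T k] assms(1,2)
    unfolding jk by (simp add: i node_Suc)
qed

lemma piecewise_linear_mesh_linear:
  assumes "0 < T" "1 \<le> k"
  shows "piecewise_linear T k (mesh_linear T k X)"
  unfolding piecewise_linear_def
proof (intro allI impI)
  fix j assume j: "j < k"
  show "\<exists>w. \<forall>t\<in>{node T k j..node T k (Suc j)}. mesh_linear T k X t = mesh_linear T k X (node T k j) + (t - node T k j) *\<^sub>R w"
    using j assms by (intro exI[of _ "(X (Suc j) - X j) /\<^sub>R step T k"])
      (auto simp: mesh_linear_eq mesh_linear_node divide_inverse)
qed

text \<open>The nodes are finitely many and hence negligible; every other point of the interval lies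
  inside an open cell, on which the interpolant is affine.\<close>

lemma is_derivative_mesh_linear:
  fixes X :: "nat \<Rightarrow> 'a::euclidean_space"
  assumes T: "0 < T" "1 \<le> k"
  shows "is_derivative T (mesh_linear T k X)
    (\<lambda>t. (X (Suc (mesh_index T k t)) - X (mesh_index T k t)) /\<^sub>R step T k)"
  unfolding is_derivative_def
proof -
  let ?N = "node T k ` {..k}"
  let ?D = "\<lambda>t. (mesh_linear T k X has_vector_derivative
    (X (Suc (mesh_index T k t)) - X (mesh_index T k t)) /\<^sub>R step T k) (at t within {0..T})"
  have D: "?D t" if t: "t \<in> {0..T}" "t \<notin> ?N" for t
  proof -
    define j where "j = mesh_index T k t"
    have jk: "j < k" unfolding j_def by (rule mesh_index_less[OF T(2)])
    have "t \<in> {node T k j..node T k (Suc j)}" unfolding j_def by (rule mesh_index_bounds[OF T t(1)])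
    moreover have "t \<noteq> node T k j" "t \<noteq> node T k (Suc j)" using t(2) jk by auto
    ultimately have tj: "t \<in> {node T k j<..<node T k (Suc j)}" by auto
    have "((\<lambda>t. X j + ((t - node T k j) / step T k) *\<^sub>R (X (Suc j) - X j)) has_vector_derivative
       (X (Suc j) - X j) /\<^sub>R step T k) (at t)"
      by (auto intro!: derivative_eq_intros simp: divide_inverse)
    then have "(mesh_linear T k X has_vector_derivative (X (Suc j) - X j) /\<^sub>R step T k) (at t)"
      by (rule has_vector_derivative_transform_within_open[OF _ open_greaterThanLessThan tj])
         (rule mesh_linear_eq[OF T(1) jk, symmetric], auto)
    then show ?thesis unfolding j_def by (rule has_vector_derivative_at_within)
  qed
  have "negligible ?N" by (intro negligible_finite) auto
  then have "AE t in lebesgue. t \<in> {0..T} \<longrightarrow> ?D t"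
    unfolding eventually_ae_filter_negligible using D by (intro exI[of _ ?N]) blast
  then show "AE t in lebesgue_on {0..T}. ?D t"
    by (subst AE_restrict_space_iff) auto
qed

text \<open>The cell index is monotone in time, so any partition meets the values of
  \<open>d\<close> in their order, possibly skipping some, and cannot collect more than the sum of
  all successive jumps.\<close>

lemma total_variation_mesh_step_le:
  fixes d :: "nat \<Rightarrow> 'a::real_normed_vector"
  assumes T: "0 < T" "1 \<le> k"
  shows "total_variation (\<lambda>t. d (mesh_index T k t)) 0 T \<le> ennreal (\<Sum>l<k - 1. norm (d (Suc l) - d l))"
  unfolding total_variation_def
proof (rule SUP_least, clarify)
  fix N p
  assume p: "\<forall>i\<le>N. p i \<in> {0..T}" "\<forall>i<N. p i \<le> p (Suc i)"
  \<comment> \<open>The accumulated variation \<open>G\<close> dominates the jumps of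
    \<open>d\<close>, and its own increments telescope.\<close>
  define G where "G m = (\<Sum>l<m. norm (d (Suc l) - d l))" for m
  have G: "norm (d n - d m) \<le> G n - G m" if "m \<le> n" for m n
    using that
  proof (induction n rule: dec_induct)
    case (step n)
    have "norm (d (Suc n) - d m) \<le> norm (d (Suc n) - d n) + norm (d n - d m)"
      using norm_triangle_ineq[of "d (Suc n) - d n" "d n - d m"] by simp
    then show ?case using step by (simp add: G_def)
  qed simp
  have Gmono: "G m \<le> G n" if "m \<le> n" for m n
    using G[OF that] norm_ge_zero[of "d n - d m"] by linarith
  let ?i = "\<lambda>i. mesh_index T k (p i)"
  have "(\<Sum>i<N. norm (d (?i (Suc i)) - d (?i i))) \<le> (\<Sum>i<N. G (?i (Suc i)) - G (?i i))"
    by (rule sum_mono) (use p T in \<open>auto intro!: G mesh_index_mono\<close>)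
  also have "\<dots> = G (?i N) - G (?i 0)" by (rule sum_lessThan_telescope[of "\<lambda>i. G (?i i)" N])
  also have "\<dots> \<le> G (k - 1)"
  proof -
    have "0 \<le> G (?i 0)" by (simp add: G_def sum_nonneg)
    moreover have "G (?i N) \<le> G (k - 1)" using mesh_index_less[OF T(2), of T "p N"] by (intro Gmono) simp
    ultimately show ?thesis by linarith
  qed
  finally show "(\<Sum>i<N. ennreal (norm (d (?i (Suc i)) - d (?i i)))) \<le> ennreal (\<Sum>l<k - 1. norm (d (Suc l) - d l))"
    by (simp add: G_def ennreal_leI)
qed

lemma mesh_step_measurable:
  fixes d :: "nat \<Rightarrow> 'a::euclidean_space"
  shows "(\<lambda>t. d (mesh_index T k t)) \<in> borel_measurable (lebesgue_on {0..T})"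
proof -
  have "(\<lambda>t. d (mesh_index T k t)) \<in> borel_measurable borel"
    unfolding mesh_index_def by measurable
  then show ?thesis
    by (intro measurable_restrict_space1 measurable_completion) simp
qed

text \<open>Each \<open>c j\<close> is at most \<open>D\<close>, so the squares sum to at most
  \<open>D * D\<close>; all cells have length \<open>step T k\<close>. A bound on the sum of the
  cellwise errors thus becomes an L2 rate of order \<open>sqrt (step T k)\<close>.\<close>

lemma L2_norm_mesh_bound:
  fixes z :: "real \<Rightarrow> 'a::euclidean_space"
  assumes T: "0 < T" "1 \<le> k" and z: "z \<in> borel_measurable (lebesgue_on {0..T})"
    and zc: "\<And>t. t \<in> {0..T} \<Longrightarrow> norm (z t) \<le> c (mesh_index T k t)"
    and c: "\<And>j. j < k \<Longrightarrow> 0 \<le> c j" "(\<Sum>j<k. c j) \<le> D"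
  shows "z \<in> L2_space T \<and> L2_norm T z \<le> sqrt (step T k) * D"
proof -
  let ?M = "lebesgue_on {0..T}"
  let ?J = "\<lambda>j. {node T k j..node T k (Suc j)}"
  \<comment> \<open>The closed cells overlap at the nodes, which only enlarges this
    majorant.\<close>
  let ?B = "\<lambda>t. \<Sum>j<k. (c j)\<^sup>2 * indicator (?J j) t :: real"
  have s: "0 < step T k" by (rule step_pos[OF T])
  have Jsub: "?J j \<subseteq> {0..T}" if "j < k" for j
    using node_in_interval[OF T, of j] node_in_interval[OF T, of "Suc j"] that by auto
  have mJ: "measure ?M (?J j) = step T k" if "j < k" for j
    using Jsub[OF that] s by (subst measure_restrict_space) (auto simp: node_Suc)
  have intJ: "integrable ?M (indicator (?J j) :: real \<Rightarrow> real)" if "j < k" for j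
    using Jsub[OF that] by (intro integrable_real_indicator)
     (auto simp: sets_restrict_space_iff emeasure_restrict_space emeasure_lborel_Icc_eq)
  have intB: "integrable ?M ?B" by (intro Bochner_Integration.integrable_sum integrable_mult_right intJ) auto
  have le: "(norm (z t))\<^sup>2 \<le> ?B t" if t: "t \<in> {0..T}" for t
  proof -
    let ?j = "mesh_index T k t"
    have "(norm (z t))\<^sup>2 \<le> (c ?j)\<^sup>2" using zc[OF t] by (intro power_mono) auto
    also have "\<dots> = (c ?j)\<^sup>2 * indicator (?J ?j) t" using mesh_index_bounds[OF T t] by simp
    also have "\<dots> \<le> ?B t"
      by (rule member_le_sum[of ?j "{..<k}" "\<lambda>j. (c j)\<^sup>2 * indicator (?J j) t"]) (auto simp: mesh_index_less[OF T(2)])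
    finally show ?thesis .
  qed
  have intz: "integrable ?M (\<lambda>t. (norm (z t))\<^sup>2)"
  proof (rule Bochner_Integration.integrable_bound[OF intB])
    show "(\<lambda>t. (norm (z t))\<^sup>2) \<in> borel_measurable ?M" using z by measurable
    show "AE t in ?M. norm ((norm (z t))\<^sup>2) \<le> norm (?B t)"
    proof (rule AE_I2)
      fix t assume "t \<in> space ?M"
      then have "(norm (z t))\<^sup>2 \<le> \<bar>?B t\<bar>" by (intro order_trans[OF le abs_ge_self]) simp
      then show "norm ((norm (z t))\<^sup>2) \<le> norm (?B t)" unfolding real_norm_def abs_power2 .
    qed
  qed
  then have "z \<in> L2_space T" using z by (simp add: L2_space_def)
  have "0 \<le> (\<Sum>j<k. c j)" using c(1) by (intro sum_nonneg) auto
  then have D: "0 \<le> D" using c(2) by simp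
  have "(\<integral>t. (norm (z t))\<^sup>2 \<partial>?M) \<le> (\<integral>t. ?B t \<partial>?M)"
    by (rule integral_mono[OF intz intB], rule le) simp
  also have "\<dots> = (\<Sum>j<k. (c j)\<^sup>2 * step T k)"
  proof (subst Bochner_Integration.integral_sum)
    have "(\<integral>t. (indicator (?J j) t :: real) \<partial>?M) = step T k" if "j < k" for j
      using Jsub[OF that] mJ[OF that] by (simp add: Int_absorb2 del: Int_atLeastAtMost)
    then show "(\<Sum>j<k. \<integral>t. (c j)\<^sup>2 * indicator (?J j) t \<partial>?M) = (\<Sum>j<k. (c j)\<^sup>2 * step T k)"
      by (intro sum.cong) auto
  qed (intro integrable_mult_right intJ, simp)
  also have "\<dots> \<le> (\<Sum>j<k. c j * D * step T k)"
  proof (rule sum_mono)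
    fix j assume j: "j \<in> {..<k}"
    have "c j \<le> (\<Sum>j<k. c j)" using j c(1) by (intro member_le_sum) auto
    then have "c j \<le> D" using c(2) by simp
    then show "(c j)\<^sup>2 * step T k \<le> c j * D * step T k"
      using j c(1) s by (auto simp: power2_eq_square intro!: mult_left_mono mult_right_mono)
  qed
  also have "\<dots> = (\<Sum>j<k. c j) * (D * step T k)" by (simp add: sum_distrib_right mult.assoc)
  also have "\<dots> \<le> D * (D * step T k)" using c(2) D s by (intro mult_right_mono) auto
  finally have "L2_norm T z \<le> sqrt (D * (D * step T k))" unfolding L2_norm_def by simp
  also have "\<dots> = sqrt (step T k) * D" using D by (simp add: real_sqrt_mult mult.commute)
  finally show ?thesis using \<open>z \<in> L2_space T\<close> by blast
qed

text \<open>The error at the left node of the cell is \<open>E\<close>, and from there the two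
  functions drift apart at speed at most \<open>D\<close> for a time of at most one step.\<close>

lemma mesh_linear_near:
  fixes y :: "real \<Rightarrow> 'a::euclidean_space"
  assumes T: "0 < T" "1 \<le> k" and y: "abs_continuous T y" "is_derivative T y dy"
    and E: "\<And>j. j < k \<Longrightarrow> norm (X j - y (node T k j)) \<le> E"
    and D: "\<And>j t. \<lbrakk>j < k; t \<in> {node T k j..node T k (Suc j)}\<rbrakk>
         \<Longrightarrow> norm ((X (Suc j) - X j) /\<^sub>R step T k - dy t) \<le> D"
    and t: "t \<in> {0..T}"
  shows "norm (mesh_linear T k X t - y t) \<le> E + D * step T k"
proof -
  define j where "j = mesh_index T k t"
  define w where "w = (X (Suc j) - X j) /\<^sub>R step T k"
  have jk: "j < k" unfolding j_def by (rule mesh_index_less[OF T(2)])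
  have tj: "t \<in> {node T k j..node T k (Suc j)}" unfolding j_def by (rule mesh_index_bounds[OF T t])
  have D0: "0 \<le> D" using order_trans[OF norm_ge_zero D[OF jk tj]] .
  have "mesh_linear T k X t = X j + (t - node T k j) *\<^sub>R w"
    using mesh_linear_eq[OF T(1) jk tj, of X] by (simp add: w_def divide_inverse)
  then have "mesh_linear T k X t - y t
      = (X j - y (node T k j)) - (y t - y (node T k j) - (t - node T k j) *\<^sub>R w)" by simp
  then have "norm (mesh_linear T k X t - y t)
      \<le> norm (X j - y (node T k j)) + norm (y t - y (node T k j) - (t - node T k j) *\<^sub>R w)"
    by (metis norm_triangle_ineq4)
  also have "norm (y t - y (node T k j) - (t - node T k j) *\<^sub>R w) \<le> D * (t - node T k j)"
  proof (rule diff_near_slope[OF y])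
    fix r assume "r \<in> {node T k j..t}"
    then show "norm (dy r - w) \<le> D"
      using D[OF jk, of r] tj by (auto simp: w_def norm_minus_commute)
  qed (use t tj node_in_interval[OF T, of j] jk in auto)
  also have "D * (t - node T k j) \<le> D * step T k"
    using tj D0 by (intro mult_left_mono) (auto simp: node_Suc)
  finally show ?thesis using E[OF jk] by linarith
qed

lemma L2_tendstoI:
  fixes y :: "real \<Rightarrow> 'a::euclidean_space"
  assumes z: "\<And>k. 1 \<le> k \<Longrightarrow> (\<lambda>t. ys k t - y t) \<in> L2_space T \<and> L2_norm T (\<lambda>t. ys k t - y t) \<le> B k"
    and B: "B \<longlonglongrightarrow> 0"
  shows "L2_tendsto T ys y"
  unfolding L2_tendsto_def
proof
  have ev: "\<forall>\<^sub>F k::nat in sequentially. 1 \<le> k" by (rule eventually_ge_at_top)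
  then show "\<forall>\<^sub>F k in sequentially. (\<lambda>t. ys k t - y t) \<in> L2_space T"
    by eventually_elim (use z in blast)
  show "(\<lambda>k. L2_norm T (\<lambda>t. ys k t - y t)) \<longlonglongrightarrow> 0"
  proof (rule tendsto_sandwich[OF _ _ tendsto_const B])
    show "\<forall>\<^sub>F k in sequentially. 0 \<le> L2_norm T (\<lambda>t. ys k t - y t)" by (simp add: L2_norm_def)
    show "\<forall>\<^sub>F k in sequentially. L2_norm T (\<lambda>t. ys k t - y t) \<le> B k"
      using ev by eventually_elim (use z in blast)
  qed
qed

section \<open>Discretization of the sweeping process\<close>

text \<open>Iterating the recursion gives the factor \<open>(1 + h * L) ^ j\<close>; with
  \<open>1 + h * L \<le> exp (h * L)\<close> and \<open>j \<le> k\<close> the bound becomes uniform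
  over the mesh.\<close>

lemma discrete_gronwall:
  fixes e V :: "nat \<Rightarrow> real"
  assumes "e 0 = 0" and step: "\<And>j. j < k \<Longrightarrow> e (Suc j) \<le> (1 + h * L) * e j + h * V j"
    and h: "0 \<le> h" "0 \<le> L" and V: "\<And>j. 0 \<le> V j" and jk: "j \<le> k"
  shows "e j \<le> exp (L * (real k * h)) * (h * (\<Sum>i<k. V i))"
proof -
  have "e j \<le> (1 + h * L) ^ j * (h * (\<Sum>i<j. V i))"
    using jk
  proof (induction j)
    case (Suc j)
    \<comment> \<open>Since the power is at least 1, it may also multiply the new term
      \<open>h * V j\<close>, so that all terms share one factor.\<close>
    have one: "1 \<le> (1 + h * L) ^ Suc j" using h by (intro one_le_power) simp
    have "e (Suc j) \<le> (1 + h * L) * e j + h * V j" using step Suc.prems by simp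
    also have "\<dots> \<le> (1 + h * L) * ((1 + h * L) ^ j * (h * (\<Sum>i<j. V i))) + (1 + h * L) ^ Suc j * (h * V j)"
      using Suc h V one mult_right_mono[OF one, of "h * V j"] by (intro add_mono mult_left_mono) auto
    finally show ?case by (simp add: algebra_simps)
  qed (simp add: assms)
  also have "\<dots> \<le> exp (L * (real k * h)) * (h * (\<Sum>i<k. V i))"
  proof (rule mult_mono)
    have "(1 + h * L) ^ j \<le> exp (h * L) ^ j" using h by (intro power_mono exp_ge_add_one_self) auto
    also have "\<dots> = exp (real j * (h * L))" by (simp add: exp_of_nat_mult)
    also have "\<dots> \<le> exp (L * (real k * h))"
      using jk h mult_right_mono[of "real j" "real k" "h * L"] by (simp add: mult_ac)
    finally show "(1 + h * L) ^ j \<le> exp (L * (real k * h))" .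
    show "h * (\<Sum>i<j. V i) \<le> h * (\<Sum>i<k. V i)"
      using jk h V by (intro mult_left_mono sum_mono2) auto
  qed (use h V in \<open>auto intro!: mult_nonneg_nonneg sum_nonneg\<close>)
  finally show ?thesis .
qed

text \<open>The node errors \<open>E\<close> are of first order in the step, and \<open>K\<close> is
  the sum of the Lipschitz errors \<open>L * E\<close> over all \<open>k\<close> cells, hence
  independent of \<open>k\<close>. The cellwise deviations \<open>cx\<close>, \<open>cu\<close>,
  \<open>ca\<close> of the slopes and controls have bounded sums, the form in which both the L2
  rates and the variation bound can use them.\<close>

lemma sweeping_discretization:
  fixes f :: "real^'n \<Rightarrow> real^'d \<Rightarrow> real^'n" and x u dx du :: "real \<Rightarrow> real^'n" and a :: "real \<Rightarrow> real^'d"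
  assumes T: "0 < T" "1 \<le> k" and L: "0 < L"
    and lip: "\<And>x1 x2 b. norm (f x1 b - f x2 b) \<le> L * norm (x1 - x2)"
    and x: "abs_continuous T x" "is_derivative T x dx" and u: "abs_continuous T u" "is_derivative T u du"
    and mu: "0 \<le> \<mu>" and tv: "total_variation dx 0 T \<le> ennreal \<mu>" "total_variation du 0 T \<le> ennreal \<mu>"
      "total_variation a 0 T \<le> ennreal \<mu>"
    and sample: "\<And>t. \<lbrakk>0 \<le> t; t < T\<rbrakk> \<Longrightarrow> \<exists>(s::nat \<Rightarrow> real) p b. (\<forall>n. s n \<in> {t<..<T}) \<and> s \<longlonglongrightarrow> t \<and>
       (\<lambda>n. dx (s n)) \<longlonglongrightarrow> p \<and> (\<lambda>n. a (s n)) \<longlonglongrightarrow> b \<and> b \<in> A \<and> f (x t) b - p \<in> normal_cone S (x t - u t)"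
  defines "E \<equiv> step T k * \<mu> * exp (L * T)" and "K \<equiv> L * T * \<mu> * exp (L * T)"
  obtains X U b v and cx cu ca :: "nat \<Rightarrow> real" where
    "X 0 = x 0" "U 0 = u 0"
    "\<And>j. j < k \<Longrightarrow> (X (Suc j) - X j) /\<^sub>R step T k = v j"
    "\<And>j. j < k \<Longrightarrow> b j \<in> A"
    "\<And>j. j < k \<Longrightarrow> f (X j) (b j) - v j \<in> normal_cone S (X j - U j)"
    "\<And>j. j \<le> k \<Longrightarrow> norm (X j - x (node T k j)) \<le> E"
    "\<And>j. j \<le> k \<Longrightarrow> norm (U j - u (node T k j)) \<le> E"
    "\<And>j t. \<lbrakk>j < k; t \<in> {node T k j..node T k (Suc j)}\<rbrakk> \<Longrightarrow> norm (v j - dx t) \<le> cx j"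
    "\<And>j t. \<lbrakk>j < k; t \<in> {node T k j..node T k (Suc j)}\<rbrakk>
        \<Longrightarrow> norm ((U (Suc j) - U j) /\<^sub>R step T k - du t) \<le> cu j"
    "\<And>j t. \<lbrakk>j < k; t \<in> {node T k j..node T k (Suc j)}\<rbrakk> \<Longrightarrow> norm (b j - a t) \<le> ca j"
    "\<And>j. 0 \<le> cx j" "\<And>j. 0 \<le> cu j" "\<And>j. 0 \<le> ca j"
    "(\<Sum>j<k. cx j) \<le> 2 * \<mu> + K" "(\<Sum>j<k. cu j) \<le> 2 * \<mu> + K" "(\<Sum>j<k. ca j) \<le> 2 * \<mu> + K"
    "(\<Sum>j<k - 1. norm ((U (Suc (Suc j)) - U (Suc j)) /\<^sub>R step T k - (U (Suc j) - U j) /\<^sub>R step T k)) \<le> 3 * \<mu> + 2 * K"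
    "\<And>j. j < k \<Longrightarrow> norm ((U (Suc j) - U j) /\<^sub>R step T k
        - (u (node T k (Suc j)) - u (node T k j)) /\<^sub>R step T k) \<le> \<mu> + K"
proof -
  let ?t = "node T k"
  define h where "h = step T k"
  have h: "0 < h" unfolding h_def by (rule step_pos[OF T])
  have kh: "real k * h = T" using T by (simp add: h_def step_def)
  have tS: "?t (Suc j) = ?t j + h" for j by (simp add: node_Suc h_def)
  have tin: "?t j \<in> {0..T}" if "j \<le> k" for j using node_in_interval[OF T that] .
  have tlt: "?t j < T" if "j < k" for j using tin[of "Suc j"] tS[of j] h that by auto
  have E0: "0 \<le> E" using h mu by (simp add: E_def h_def)
  have kE: "real k * (L * E) = K" using kh by (simp add: E_def K_def h_def mult_ac)
  have LE: "L * E \<le> K"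
    using mult_right_mono[of 1 "real k" "L * E"] T(2) L E0 kE by simp
  have K0: "0 \<le> K" using LE L E0 by (meson less_imp_le mult_nonneg_nonneg order_trans)
  have mesh: "\<forall>j<k. ?t j \<le> ?t (Suc j)" "\<forall>j\<le>k. ?t j \<in> {0..T}" using h tS tin by auto
  obtain Vx where Vx0: "\<forall>j. 0 \<le> Vx j"
    and Vx1: "\<forall>j<k. \<forall>s\<in>{?t j..?t (Suc j)}. \<forall>t\<in>{?t j..?t (Suc j)}. norm (dx s - dx t) \<le> Vx j"
    and Vx3: "(\<Sum>j<k. Vx j) \<le> \<mu>"
    using variation_oscillation[OF tv(1) mu mesh(1,2)] by (elim exE conjE) (rule that)
  note Vx = Vx0[rule_format] Vx1[rule_format] Vx3
  obtain Vu where Vu0: "\<forall>j. 0 \<le> Vu j"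
    and Vu1: "\<forall>j<k. \<forall>s\<in>{?t j..?t (Suc j)}. \<forall>t\<in>{?t j..?t (Suc j)}. norm (du s - du t) \<le> Vu j"
    and Vu3: "(\<Sum>j<k. Vu j) \<le> \<mu>"
    using variation_oscillation[OF tv(2) mu mesh(1,2)] by (elim exE conjE) (rule that)
  note Vu = Vu0[rule_format] Vu1[rule_format] Vu3
  obtain Va where Va0: "\<forall>j. 0 \<le> Va j"
    and Va1: "\<forall>j<k. \<forall>s\<in>{?t j..?t (Suc j)}. \<forall>t\<in>{?t j..?t (Suc j)}. norm (a s - a t) \<le> Va j"
    and Va3: "(\<Sum>j<k. Va j) \<le> \<mu>"
    using variation_oscillation[OF tv(3) mu mesh(1,2)] by (elim exE conjE) (rule that)
  note Va = Va0[rule_format] Va1[rule_format] Va3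
  \<comment> \<open>The guard \<open>j < k\<close> makes the statement satisfiable for every
    \<open>j\<close>, so that the samples of all nodes can be chosen at once.\<close>
  define P where "P j s p b \<longleftrightarrow> (j < k \<longrightarrow> (\<forall>n. s n \<in> {?t j<..<T}) \<and> s \<longlonglongrightarrow> ?t j \<and>
       (\<lambda>n. dx (s n)) \<longlonglongrightarrow> p \<and> (\<lambda>n. a (s n)) \<longlonglongrightarrow> b \<and> b \<in> A \<and>
       f (x (?t j)) b - p \<in> normal_cone S (x (?t j) - u (?t j)))" for j and s :: "nat \<Rightarrow> real" and p b
  have "\<exists>s p b. P j s p b" for j
    using sample[of "?t j"] tin[of j] tlt[of j] unfolding P_def by (cases "j < k") auto
  then obtain s p b where P: "\<And>j. P j (s j) (p j) (b j)" by metis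
  have s: "\<And>j n. j < k \<Longrightarrow> s j n \<in> {?t j<..<T}"
    "\<And>j. j < k \<Longrightarrow> s j \<longlonglongrightarrow> ?t j" "\<And>j. j < k \<Longrightarrow> (\<lambda>n. dx (s j n)) \<longlonglongrightarrow> p j"
    "\<And>j. j < k \<Longrightarrow> (\<lambda>n. a (s j n)) \<longlonglongrightarrow> b j"
    and bA: "\<And>j. j < k \<Longrightarrow> b j \<in> A"
    and inc: "\<And>j. j < k \<Longrightarrow> f (x (?t j)) (b j) - p j \<in> normal_cone S (x (?t j) - u (?t j))"
    using P unfolding P_def by blast+
  \<comment> \<open>The sample times decrease into the cell from the right of its left node only in
    the limit, so they lie in it from some index on. The limits \<open>p j\<close> and
    \<open>b j\<close> therefore inherit the oscillation bounds of the cell.\<close>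
  have cell: "\<forall>\<^sub>F n in sequentially. s j n \<in> {?t j..?t (Suc j)}" if j: "j < k" for j
  proof -
    have "\<forall>\<^sub>F n in sequentially. s j n < ?t (Suc j)"
      using h tS[of j] by (intro order_tendstoD[OF s(2)[OF j]]) simp
    then show ?thesis by (rule eventually_mono) (use s(1)[OF j] in \<open>auto simp: less_imp_le\<close>)
  qed
  have px: "norm (p j - dx t) \<le> Vx j" if "j < k" "t \<in> {?t j..?t (Suc j)}" for j t
    by (rule Lim_norm_ubound[OF _ tendsto_diff[OF s(3)[OF that(1)] tendsto_const]])
       (use eventually_mono[OF cell[OF that(1)] Vx(2)[OF that(1) _ that(2)]] in auto)
  have ba: "norm (b j - a t) \<le> Va j" if "j < k" "t \<in> {?t j..?t (Suc j)}" for j t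
    by (rule Lim_norm_ubound[OF _ tendsto_diff[OF s(4)[OF that(1)] tendsto_const]])
       (use eventually_mono[OF cell[OF that(1)] Va(2)[OF that(1) _ that(2)]] in auto)
  \<comment> \<open>An Euler step with velocity \<open>p j\<close>, corrected by the change of
    \<open>f\<close> between \<open>x\<close> at the node and \<open>X j\<close>. The correction
    cancels in \<open>f (X j) (b j) - v j\<close>, which remains the normal vector found at the
    node.\<close>
  define X where "X = rec_nat (x 0) (\<lambda>j z. z + h *\<^sub>R (p j + f z (b j) - f (x (?t j)) (b j)))"
  define F where "F j = f (X j) (b j) - f (x (?t j)) (b j)" for j
  define v where "v j = p j + F j" for j
  define U where "U j = X j - x (?t j) + u (?t j)" for j
  \<comment> \<open>The consistency error: sampled velocity minus the mean velocity of
    \<open>x\<close> over the cell.\<close>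
  define r where "r j = p j - (x (?t (Suc j)) - x (?t j)) /\<^sub>R h" for j
  define d where "d j = (U (Suc j) - U j) /\<^sub>R h" for j
  define q where "q j = (u (?t (Suc j)) - u (?t j)) /\<^sub>R h" for j
  have X0: "X 0 = x 0" by (simp add: X_def)
  have XS: "X (Suc j) = X j + h *\<^sub>R v j" for j
    by (simp add: X_def v_def F_def add_diff_eq)
  have r: "norm (r j) \<le> Vx j" if j: "j < k" for j
  proof -
    have "norm ((x (?t (Suc j)) - x (?t j)) /\<^sub>R (?t (Suc j) - ?t j) - p j) \<le> Vx j"
      by (rule diff_quotient_near[OF x])
         (use px[OF j] tin[of j] tin[of "Suc j"] tS[of j] h j in \<open>auto simp: norm_minus_commute\<close>)
    then show ?thesis by (simp add: r_def tS norm_minus_commute)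
  qed
  have F: "norm (F j) \<le> L * norm (X j - x (?t j))" for j unfolding F_def by (rule lip)
  have err: "norm (X j - x (?t j)) \<le> E" if jk: "j \<le> k" for j
  proof -
    have "norm (X j - x (?t j)) \<le> exp (L * (real k * h)) * (h * (\<Sum>i<k. Vx i))"
    \<comment> \<open>Over one step \<open>F j\<close> adds at most \<open>h * L\<close> times the
      present error and \<open>r j\<close> at most \<open>h * Vx j\<close>; the \<open>Vx j\<close>
      sum up to at most \<mu>.\<close>
    proof (rule discrete_gronwall[where e = "\<lambda>j. norm (X j - x (?t j))"])
      fix j assume j: "j < k"
      have "X (Suc j) - x (?t (Suc j)) = (X j - x (?t j)) + h *\<^sub>R F j + h *\<^sub>R r j"
        using h by (simp add: XS v_def r_def algebra_simps)
      then have "norm (X (Suc j) - x (?t (Suc j))) \<le> norm (X j - x (?t j)) + h * norm (F j) + h * norm (r j)"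
        using h by (metis (no_types, lifting) norm_triangle_mono norm_scaleR abs_of_pos norm_triangle_ineq order_refl)
      also have "\<dots> \<le> norm (X j - x (?t j)) + h * (L * norm (X j - x (?t j))) + h * Vx j"
        using h F[of j] r[OF j] by (intro add_mono mult_left_mono) auto
      finally show "norm (X (Suc j) - x (?t (Suc j))) \<le> (1 + h * L) * norm (X j - x (?t j)) + h * Vx j"
        by (simp add: algebra_simps)
    qed (use X0 h L Vx jk in auto)
    also have "\<dots> \<le> exp (L * (real k * h)) * (h * \<mu>)"
      using h Vx(3) by (intro mult_left_mono) auto
    finally show ?thesis unfolding kh by (simp add: E_def h_def mult_ac)
  qed
  have FE: "norm (F j) \<le> L * E" if "j < k" for j
    by (rule order_trans[OF F mult_left_mono[OF err]]) (use that L in auto)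
  \<comment> \<open>At the nodes \<open>U - u\<close> equals \<open>X - x\<close>, so the slopes of
    \<open>U\<close> and \<open>u\<close> differ by exactly what the slopes of \<open>X\<close> and
    \<open>x\<close> differ by, namely \<open>F j + r j\<close>.\<close>
  have d: "d j = F j + r j + q j" for j
    using h by (simp add: d_def U_def XS v_def r_def q_def algebra_simps)
  have dq: "norm (d j - q j) \<le> L * E + Vx j" if "j < k" for j
    using norm_triangle_ineq[of "F j" "r j"] FE[OF that] r[OF that] unfolding d by simp
  have qu: "norm (q j - du t) \<le> Vu j" if j: "j < k" and t: "t \<in> {?t j..?t (Suc j)}" for j t
  proof -
    have "norm ((u (?t (Suc j)) - u (?t j)) /\<^sub>R (?t (Suc j) - ?t j) - du t) \<le> Vu j"
      by (rule diff_quotient_near[OF u])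
         (use Vu(2)[OF j _ t] tin[of j] tin[of "Suc j"] tS[of j] h j in auto)
    then show ?thesis by (simp add: q_def tS)
  qed
  have second: "(\<Sum>j<k - 1. norm (q (Suc j) - q j)) \<le> \<mu>"
  proof -
    \<comment> \<open>With \<open>m = k - 1\<close> the bound on second differences covers
      \<open>Suc m = k\<close> cells, which end exactly at \<open>T\<close>.\<close>
    have k: "Suc (k - 1) = k" using T(2) by simp
    have "(\<Sum>j<k - 1. norm ((u (real (Suc (Suc j)) * h) - u (real (Suc j) * h)) - (u (real (Suc j) * h) - u (real j * h)))) \<le> h * \<mu>"
      using sum_second_differences_le[OF u tv(2) mu, of h "k - 1"] h kh unfolding k by simp
    also have "(\<Sum>j<k - 1. norm ((u (real (Suc (Suc j)) * h) - u (real (Suc j) * h)) - (u (real (Suc j) * h) - u (real j * h))))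
       = (\<Sum>j<k - 1. h * norm (q (Suc j) - q j))"
    proof (rule sum.cong[OF refl])
      fix j
      have "h * norm (q (Suc j) - q j) = norm (h *\<^sub>R (q (Suc j) - q j))" using h by simp
      also have "h *\<^sub>R (q (Suc j) - q j)
          = (u (real (Suc (Suc j)) * h) - u (real (Suc j) * h)) - (u (real (Suc j) * h) - u (real j * h))"
        using h by (simp add: q_def node_def h_def[symmetric] scaleR_diff_right scaleR_add_right)
      finally show "norm ((u (real (Suc (Suc j)) * h) - u (real (Suc j) * h)) - (u (real (Suc j) * h) - u (real j * h)))
          = h * norm (q (Suc j) - q j)" by simp
    qed
    finally show ?thesis using h by (simp add: sum_distrib_left[symmetric])
  qed
  \<comment> \<open>The bound for both \<open>F j + r j\<close> and \<open>v j - dx t\<close>: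
    Lipschitz error plus oscillation of \<open>dx\<close> on the cell. Its sum is at most
    \<open>K + \<mu>\<close>.\<close>
  define w where "w j = L * E + Vx j" for j
  have w: "(\<Sum>j<k. w j) \<le> K + \<mu>" using Vx(3) kE by (simp add: w_def sum.distrib)
  have w0: "0 \<le> w j" for j using L E0 Vx(1) by (simp add: w_def)
  have wle: "w j \<le> \<mu> + K" if "j < k" for j
    using member_le_sum[of j "{..<k}" w] that w0 w by simp
  show thesis
  proof (rule that[of X U v b w "\<lambda>j. w j + Vu j" Va])
    show "X 0 = x 0" by (rule X0)
    show "U 0 = u 0" by (simp add: U_def X0)
    show "(X (Suc j) - X j) /\<^sub>R step T k = v j" if "j < k" for j
      using h by (simp add: XS h_def[symmetric])
    show "b j \<in> A" if "j < k" for j using bA that .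
    show "f (X j) (b j) - v j \<in> normal_cone S (X j - U j)" if "j < k" for j
      using inc[OF that] by (simp add: v_def F_def U_def algebra_simps)
    show "norm (X j - x (?t j)) \<le> E" if "j \<le> k" for j using err that .
    show "norm (U j - u (?t j)) \<le> E" if "j \<le> k" for j using err[OF that] by (simp add: U_def)
    show "norm (v j - dx t) \<le> w j" if "j < k" "t \<in> {?t j..?t (Suc j)}" for j t
      using norm_triangle_ineq[of "F j" "p j - dx t"] FE[of j] px[of j t] that by (simp add: v_def w_def algebra_simps)
    show "norm ((U (Suc j) - U j) /\<^sub>R step T k - du t) \<le> w j + Vu j" if "j < k" "t \<in> {?t j..?t (Suc j)}" for j t
      using norm_triangle_ineq[of "d j - q j" "q j - du t"] dq[of j] qu[of j t] that
      by (simp add: w_def d_def[symmetric] h_def[symmetric])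
    show "norm (b j - a t) \<le> Va j" if "j < k" "t \<in> {?t j..?t (Suc j)}" for j t using ba that .
    show "0 \<le> w j" "0 \<le> w j + Vu j" "0 \<le> Va j" for j using w0 Vu(1) Va(1) by auto
    show "(\<Sum>j<k. w j) \<le> 2 * \<mu> + K" "(\<Sum>j<k. Va j) \<le> 2 * \<mu> + K" "(\<Sum>j<k. w j + Vu j) \<le> 2 * \<mu> + K"
      using w Vu(3) Va(3) mu K0 by (auto simp: sum.distrib)
    show "norm ((U (Suc j) - U j) /\<^sub>R step T k - (u (?t (Suc j)) - u (?t j)) /\<^sub>R step T k) \<le> \<mu> + K" if "j < k" for j
      using dq[OF that] wle[OF that] by (simp add: w_def d_def q_def h_def)
    \<comment> \<open>A slope occurs in at most two successive differences, so \<open>w\<close> is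
      summed twice; with \<mu> for the slopes of \<open>u\<close> this gives
      \<open>2 * (K + \<mu>) + \<mu>\<close>.\<close>
    have "(\<Sum>j<k - 1. norm (d (Suc j) - d j)) \<le> (\<Sum>j<k - 1. w (Suc j) + w j + norm (q (Suc j) - q j))"
    proof (rule sum_mono)
      fix j assume "j \<in> {..<k - 1}"
      then have j: "j < k" "Suc j < k" by auto
      have "d (Suc j) - d j = (d (Suc j) - q (Suc j)) - (d j - q j) + (q (Suc j) - q j)" by simp
      then have "norm (d (Suc j) - d j) \<le> norm (d (Suc j) - q (Suc j)) + norm (d j - q j) + norm (q (Suc j) - q j)"
        by (metis norm_triangle_ineq4 norm_triangle_mono order_refl)
      then show "norm (d (Suc j) - d j) \<le> w (Suc j) + w j + norm (q (Suc j) - q j)"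
        using dq[OF j(1)] dq[OF j(2)] unfolding w_def by linarith
    qed
    also have "\<dots> = (\<Sum>j<k - 1. w (Suc j)) + (\<Sum>j<k - 1. w j) + (\<Sum>j<k - 1. norm (q (Suc j) - q j))"
      by (simp add: sum.distrib)
    also have "(\<Sum>j<k - 1. w (Suc j)) \<le> (\<Sum>j<k. w j)"
      using sum.lessThan_Suc_shift[of w "k - 1"] T(2) w0[of 0] by simp
    also have "(\<Sum>j<k - 1. w j) \<le> (\<Sum>j<k. w j)" using w0 by (intro sum_mono2) auto
    finally have "(\<Sum>j<k - 1. norm (d (Suc j) - d j)) \<le> 3 * \<mu> + 2 * K" using w second by linarith
    then show "(\<Sum>j<k - 1. norm ((U (Suc (Suc j)) - U (Suc j)) /\<^sub>R step T k - (U (Suc j) - U j) /\<^sub>R step T k)) \<le> 3 * \<mu> + 2 * K"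
      by (simp add: d_def h_def)
  qed
qed

theorem theorem3p1:
  fixes f :: "real^'n \<Rightarrow> real^'d \<Rightarrow> real^'n"
    and g :: "'m::finite \<Rightarrow> real^'n \<Rightarrow> real"
    and \<nu> :: "'s::finite \<Rightarrow> real^'n \<Rightarrow> real"
    and A :: "(real^'d) set" and \<Xi>x :: "(real^'n) set" and \<Xi>T :: "real set"
    and x0 :: "real^'n"
    and x u dx du :: "real \<Rightarrow> real^'n" and a :: "real \<Rightarrow> real^'d"
    and T Lf L\<nu> \<mu> :: real
  assumes "\<Xi>T \<subseteq> {0..}" and "T > 0"
    and "assm_f f Lf g u T" and "assm_g g" and "assm_nu \<nu> L\<nu>" and "assm_A f A"
    and "feasible f g \<nu> A \<Xi>x \<Xi>T x0 x u a T"
    and "is_derivative T x dx" and "is_derivative T u du"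
    and "bounded_variation a 0 T" and "bounded_variation du 0 T" and "bounded_variation dx 0 T"
    and "\<mu> > 0"
    and "max (max (total_variation dx 0 T) (total_variation du 0 T)) (total_variation a 0 T)
           \<le> ennreal \<mu>"
    and "\<forall>k\<ge>1. max (norm ((u (node T k 1) - u 0) /\<^sub>R step T k))
                    (norm ((u T - u (node T k (k - 1))) /\<^sub>R step T k)) \<le> \<mu>"
  shows "\<exists>(\<delta> :: nat \<Rightarrow> real) (\<mu>x :: nat \<Rightarrow> real)
          (xk :: nat \<Rightarrow> real \<Rightarrow> real^'n) (uk :: nat \<Rightarrow> real \<Rightarrow> real^'n) (ak :: nat \<Rightarrow> real \<Rightarrow> real^'d)
          (dxk :: nat \<Rightarrow> real \<Rightarrow> real^'n) (duk :: nat \<Rightarrow> real \<Rightarrow> real^'n)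
          (v :: nat \<Rightarrow> nat \<Rightarrow> real^'n).
     (\<forall>k\<ge>1. \<delta> k > 0 \<and> \<mu>x k > 0) \<and> \<delta> \<longlonglongrightarrow> 0 \<and> \<mu>x \<longlonglongrightarrow> 0 \<and>
     (\<forall>k\<ge>1.
        piecewise_linear T k (xk k) \<and> piecewise_linear T k (uk k) \<and> piecewise_constant T k (ak k) \<and>
        is_derivative T (xk k) (dxk k) \<and> is_derivative T (uk k) (duk k) \<and>
        (\<forall>j\<le>k. uk k (node T k j) \<in> (\<Inter>i. \<nu> i -` {..<L\<nu> * \<delta> k}) \<and> ak k (node T k j) \<in> A) \<and>
        (xk k T, T) \<in> {y + \<mu>x k *\<^sub>R b | y b. y \<in> \<Xi>x \<and> b \<in> ball 0 1} \<times> \<Xi>T \<and>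
        (\<forall>j<k.
           (\<forall>t\<in>{node T k j..node T k (Suc j)}.
              xk k t = xk k (node T k j) + (t - node T k j) *\<^sub>R v k j) \<and>
           - v k j \<in> vel_map f g (xk k (node T k j)) (uk k (node T k j)) (ak k (node T k j))) \<and>
        (\<forall>i. g i (xk k 0 - uk k 0) \<ge> 0)) \<and>
     uniform_limit {0..T} xk x sequentially \<and> uniform_limit {0..T} uk u sequentially \<and>
     L2_tendsto T dxk dx \<and> L2_tendsto T duk du \<and> L2_tendsto T ak a \<and>
     (\<forall>k\<ge>1.
        total_variation (duk k) 0 T \<le> ennreal (mu_tilde Lf T \<mu>) \<and>
        max (norm ((uk k (node T k 1) - uk k 0) /\<^sub>R step T k))
            (norm ((uk k T - uk k (node T k (k - 1))) /\<^sub>R step T k)) \<le> mu_tilde Lf T \<mu>)"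
proof -

  \<comment> \<open>Regularity of the data: continuity of \<open>f\<close>, closed constraint
    sets\<close>
  have L: "0 < Lf" and lip2: "norm (f x1 a1 - f x2 a2) \<le> Lf * (norm (x1 - x2) + norm (a1 - a2))" for x1 x2 a1 a2
    using assms(3) unfolding assm_f_def by blast+
  have lip: "norm (f x1 b - f x2 b) \<le> Lf * norm (x1 - x2)" for x1 x2 b
    using lip2[of x1 b x2 b] by simp
  have contf: "continuous_on UNIV (\<lambda>(x, a). f x a)"
  proof (rule lipschitz_on_continuous_on[where L = "Lf * 2"], rule lipschitz_onI)
    fix p q :: "(real^'n) \<times> (real^'d)"
    have "dist (fst p) (fst q) + dist (snd p) (snd q) \<le> 2 * dist p q"
      using dist_fst_le[of p q] dist_snd_le[of p q] by linarith
    then have "Lf * (dist (fst p) (fst q) + dist (snd p) (snd q)) \<le> Lf * (2 * dist p q)"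
      using L by (intro mult_left_mono) auto
    then show "dist (case p of (x, a) \<Rightarrow> f x a) (case q of (x, a) \<Rightarrow> f x a) \<le> Lf * 2 * dist p q"
      using lip2[of "fst p" "snd p" "fst q" "snd q"]
      by (simp add: dist_norm case_prod_beta mult.assoc)
  qed (use L in simp)
  have C1_cont: "continuous_on UNIV w" if "C1_fun w" for w :: "real^'n \<Rightarrow> real"
    using that unfolding C1_fun_def
    by (intro continuous_at_imp_continuous_on ballI differentiable_imp_continuous_within) blast
  have "C1_fun (g i)" for i using assms(4) unfolding assm_g_def C2_fun_def by blast
  then have "closed (C_comp g i)" for i
    unfolding C_comp_def by (intro closed_Collect_le continuous_on_const C1_cont)
  then have closedC: "closed (C_set g)" unfolding C_set_def by blast
  have nuC1: "C1_fun (\<nu> i)" and nulip: "\<bar>\<nu> i u2 - \<nu> i u1\<bar> \<le> L\<nu> * norm (u2 - u1)" and Lnu: "0 < L\<nu>" for i u1 u2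
    using assms(5) unfolding assm_nu_def by blast+
  have "closed (U_comp \<nu> i)" for i
    unfolding U_comp_def vimage_def atMost_iff mem_Collect_eq
    using closed_Collect_le[OF C1_cont[OF nuC1[of i]] continuous_on_const[of UNIV 0]] by simp
  then have closedU: "closed (U_set \<nu>)" unfolding U_set_def by blast
  have compA: "compact A" using assms(6) by (simp add: assm_A_def)

  \<comment> \<open>The feasible process at individual times\<close>
  have acx: "abs_continuous T x" and acu: "abs_continuous T u" and a2: "a \<in> L2_space T"
    and ae: "AE t in lebesgue_on {0..T}.
        - vector_derivative x (at t within {0..T}) \<in> vel_map f g (x t) (u t) (a t) \<and> u t \<in> U_set \<nu> \<and> a t \<in> A"
    and x0: "x 0 = x0" "x0 \<in> C_moved g (u 0)" and xT: "x T \<in> \<Xi>x" "T \<in> \<Xi>T"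
    using assms(7) unfolding feasible_def W12_space_def by blast+
  note dx = assms(8) and du = assms(9) and T = assms(2)
  have tv: "total_variation dx 0 T \<le> ennreal \<mu>" "total_variation du 0 T \<le> ennreal \<mu>" "total_variation a 0 T \<le> ennreal \<mu>"
    using assms(14) by auto
  have mu: "0 \<le> \<mu>" using assms(13) by simp
  have contx: "continuous_on {0..T} x" by (rule abs_continuous_imp_continuous_on[OF acx dx])
  have contu: "continuous_on {0..T} u" by (rule abs_continuous_imp_continuous_on[OF acu du])
  have meas: "dx \<in> borel_measurable (lebesgue_on {0..T})" "du \<in> borel_measurable (lebesgue_on {0..T})"
    "a \<in> borel_measurable (lebesgue_on {0..T})"
    using abs_continuous_has_integral[OF acx dx, of 0 T] abs_continuous_has_integral[OF acu du, of 0 T] T a2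
    by (auto intro!: integrable_imp_measurable has_integral_integrable simp: L2_space_def)
  have inc: "AE t in lebesgue_on {0..T}. f (x t) (a t) - dx t \<in> normal_cone (C_set g) (x t - u t) \<and> a t \<in> A"
    using ae dx[unfolded is_derivative_def] AE_space
  proof eventually_elim
    case (elim t)
    \<comment> \<open>Since \<open>T > 0\<close>, the derivative within the closed interval is
      unique, also at the endpoints, so \<open>dx t\<close> is the velocity in the feasibility
      inclusion.\<close>
    then have "vector_derivative x (at t within {0..T}) = dx t"
      using T by (intro vector_derivative_within_closed_interval) auto
    then obtain \<eta> where "- dx t = \<eta> - f (x t) (a t)" "\<eta> \<in> normal_cone (C_set g) (x t - u t)"
      using elim by (auto simp: vel_map_def)
    moreover from this have "\<eta> = f (x t) (a t) - dx t" by (simp add: algebra_simps eq_diff_eq)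
    ultimately show ?case using elim by simp
  qed
  have inU: "u t \<in> U_set \<nu>" if "t \<in> {0..T}" for t
  proof -
    \<comment> \<open>The constraint is needed at every node, not just almost everywhere.
      \<open>S\<close> is closed and contains almost every point of the open interval, hence all of
      it and also its closure.\<close>
    define S where "S = {0..T} \<inter> u -` U_set \<nu>"
    have S: "closed S" unfolding S_def by (intro continuous_closed_preimage contu closedU) simp
    have "AE t in lebesgue_on {0..T}. u t \<in> U_set \<nu>" using ae by eventually_elim simp
    then have "AE t in lebesgue. t \<in> {0..T} \<longrightarrow> u t \<in> U_set \<nu>"
      by (subst (asm) AE_restrict_space_iff) auto
    then have "AE t \<in> {0<..<T} in lebesgue. t \<in> S" by eventually_elim (auto simp: S_def)
    then have "{0<..<T} \<subseteq> S"
      using mem_closed_if_AE_lebesgue_open[OF open_greaterThanLessThan S] by blast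
    then have "closure {0<..<T} \<subseteq> S" using S by (rule closure_minimal)
    then show ?thesis using that T by (auto simp: S_def)
  qed
  have bdd: "bounded (dx ` {0..T})"
  proof (rule bounded_subset[OF bounded_cball])
    show "dx ` {0..T} \<subseteq> cball (dx 0) \<mu>"
      using norm_diff_le_total_variation[OF tv(1) mu, of 0] T by (auto simp: dist_norm)
  qed
  have sample: "\<exists>(s::nat \<Rightarrow> real) p b. (\<forall>n. s n \<in> {t<..<T}) \<and> s \<longlonglongrightarrow> t \<and>
       (\<lambda>n. dx (s n)) \<longlonglongrightarrow> p \<and> (\<lambda>n. a (s n)) \<longlonglongrightarrow> b \<and> b \<in> A \<and>
       f (x t) b - p \<in> normal_cone (C_set g) (x t - u t)" if t: "0 \<le> t" "t < T" for t
    by (rule right_limit_in_normal_cone[OF t inc closedC contx contu bdd compA contf]) blast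

  \<comment> \<open>Constants, error rates and the properties required on one mesh\<close>
  define K where "K = Lf * T * \<mu> * exp (Lf * T)"
  define D where "D = 2 * \<mu> + K"
  define E where "E k = step T k * \<mu> * exp (Lf * T)" for k
  \<comment> \<open>The witness for both tolerance sequences. The extra step turns the node errors
    \<open>E k\<close> into strict inequalities, as the open half-lines and the open ball
    demand.\<close>
  define \<epsilon> where "\<epsilon> k = E k + step T k" for k
  have K0: "0 \<le> K" using L T mu by (simp add: K_def)
  have muK: "3 * \<mu> + 2 * K \<le> mu_tilde Lf T \<mu>"
  proof -
    \<comment> \<open>The first entry of the maximum contains \<open>4 * K * (2 * Lf + 1)\<close>,
      which dominates \<open>2 * K\<close>.\<close>
    have "2 * K \<le> 4 * (K * (2 * Lf + 1))" using K0 L mult_nonneg_nonneg[of K Lf] by (simp add: algebra_simps)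
    moreover have "4 * Lf * T * \<mu> * exp (Lf * T) * (2 * Lf + 1) = 4 * (K * (2 * Lf + 1))" by (simp add: K_def)
    moreover have "0 \<le> 2 * Lf * \<mu>" using L mu by simp
    ultimately show ?thesis unfolding mu_tilde_def by linarith
  qed
  have step0: "(\<lambda>k. step T k) \<longlonglongrightarrow> 0" unfolding step_def by (rule lim_const_over_n)
  have E0: "E \<longlonglongrightarrow> 0"
    unfolding E_def using tendsto_mult_right[OF step0, of "\<mu> * exp (Lf * T)"] by (simp add: mult.assoc)
  \<comment> \<open>All conclusions for one mesh, with the limits replaced by explicit rates, so
    that the functions for each \<open>k\<close> are chosen only once.\<close>
  define R where "R k xk uk ak dxk duk v \<longleftrightarrow>
        (piecewise_linear T k xk \<and> piecewise_linear T k uk \<and> piecewise_constant T k ak \<and>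
        is_derivative T xk dxk \<and> is_derivative T uk duk \<and>
        (\<forall>j\<le>k. uk (node T k j) \<in> (\<Inter>i. \<nu> i -` {..<L\<nu> * \<epsilon> k}) \<and> ak (node T k j) \<in> A) \<and>
        (xk T, T) \<in> {y + \<epsilon> k *\<^sub>R b | y b. y \<in> \<Xi>x \<and> b \<in> ball 0 1} \<times> \<Xi>T \<and>
        (\<forall>j<k.
           (\<forall>t\<in>{node T k j..node T k (Suc j)}. xk t = xk (node T k j) + (t - node T k j) *\<^sub>R v j) \<and>
           - v j \<in> vel_map f g (xk (node T k j)) (uk (node T k j)) (ak (node T k j))) \<and>
        (\<forall>i. g i (xk 0 - uk 0) \<ge> 0)) \<and>
        (\<forall>t\<in>{0..T}. norm (xk t - x t) \<le> E k + D * step T k \<and> norm (uk t - u t) \<le> E k + D * step T k) \<and>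
        ((\<lambda>t. dxk t - dx t) \<in> L2_space T \<and> L2_norm T (\<lambda>t. dxk t - dx t) \<le> sqrt (step T k) * D) \<and>
        ((\<lambda>t. duk t - du t) \<in> L2_space T \<and> L2_norm T (\<lambda>t. duk t - du t) \<le> sqrt (step T k) * D) \<and>
        ((\<lambda>t. ak t - a t) \<in> L2_space T \<and> L2_norm T (\<lambda>t. ak t - a t) \<le> sqrt (step T k) * D) \<and>
        (total_variation duk 0 T \<le> ennreal (mu_tilde Lf T \<mu>) \<and>
        max (norm ((uk (node T k 1) - uk 0) /\<^sub>R step T k))
            (norm ((uk T - uk (node T k (k - 1))) /\<^sub>R step T k)) \<le> mu_tilde Lf T \<mu>)"
    for k and xk uk :: "real \<Rightarrow> real^'n" and ak :: "real \<Rightarrow> real^'d" and dxk duk v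

  \<comment> \<open>Discrete trajectories on a fixed mesh\<close>
  have "\<exists>xk uk ak dxk duk v. R k xk uk ak dxk duk v" if k: "1 \<le> k" for k
  proof -
    note Tk = T k
    have s: "0 < step T k" by (rule step_pos[OF Tk])
    obtain X U b v cx cu ca where
      XU0: "X 0 = x 0" "U 0 = u 0"
      and v: "\<And>j. j < k \<Longrightarrow> (X (Suc j) - X j) /\<^sub>R step T k = v j"
      and bA: "\<And>j. j < k \<Longrightarrow> b j \<in> A"
      and vN: "\<And>j. j < k \<Longrightarrow> f (X j) (b j) - v j \<in> normal_cone (C_set g) (X j - U j)"
      and XE: "\<And>j. j \<le> k \<Longrightarrow> norm (X j - x (node T k j)) \<le> E k"
      and UE: "\<And>j. j \<le> k \<Longrightarrow> norm (U j - u (node T k j)) \<le> E k"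
      and cx: "\<And>j t. \<lbrakk>j < k; t \<in> {node T k j..node T k (Suc j)}\<rbrakk> \<Longrightarrow> norm (v j - dx t) \<le> cx j"
      and cu: "\<And>j t. \<lbrakk>j < k; t \<in> {node T k j..node T k (Suc j)}\<rbrakk>
        \<Longrightarrow> norm ((U (Suc j) - U j) /\<^sub>R step T k - du t) \<le> cu j"
      and ca: "\<And>j t. \<lbrakk>j < k; t \<in> {node T k j..node T k (Suc j)}\<rbrakk> \<Longrightarrow> norm (b j - a t) \<le> ca j"
      and c0: "\<And>j. 0 \<le> cx j" "\<And>j. 0 \<le> cu j" "\<And>j. 0 \<le> ca j"
      and cs: "(\<Sum>j<k. cx j) \<le> D" "(\<Sum>j<k. cu j) \<le> D" "(\<Sum>j<k. ca j) \<le> D"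
      and var: "(\<Sum>j<k - 1. norm ((U (Suc (Suc j)) - U (Suc j)) /\<^sub>R step T k - (U (Suc j) - U j) /\<^sub>R step T k)) \<le> 3 * \<mu> + 2 * K"
      and slope: "\<And>j. j < k \<Longrightarrow> norm ((U (Suc j) - U j) /\<^sub>R step T k
        - (u (node T k (Suc j)) - u (node T k j)) /\<^sub>R step T k) \<le> \<mu> + K"
      by (rule sweeping_discretization[OF Tk L lip acx dx acu du mu tv sample,
            folded K_def E_def, folded D_def]) (assumption | rule that)+
    define d where "d j = (U (Suc j) - U j) /\<^sub>R step T k" for j
    define xk where "xk = mesh_linear T k X"
    define uk where "uk = mesh_linear T k U"
    define ak where "ak t = b (mesh_index T k t)" for t
    \<comment> \<open>Step functions representing the derivatives: each node before \<open>T\<close>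
      takes the slope of the cell to its right, and \<open>T\<close> that of the last cell. The
      variation of \<open>duk\<close> refers to this representative.\<close>
    define dxk where "dxk t = v (mesh_index T k t)" for t
    define duk where "duk t = d (mesh_index T k t)" for t
    have idx: "mesh_index T k t < k" for t by (rule mesh_index_less[OF k])
    have xkn: "xk (node T k j) = X j" and ukn: "uk (node T k j) = U j" if "j \<le> k" for j
      using mesh_linear_node[OF Tk that] by (simp_all add: xk_def uk_def)
    have akn: "ak (node T k j) = b j" if "j < k" for j
      using mesh_index_eq[OF T that, of "node T k j"] s by (simp add: ak_def node_Suc)
    have xk0: "xk 0 = X 0" and uk0: "uk 0 = U 0" using xkn[of 0] ukn[of 0] by simp_all
    have xkT: "xk T = X k" and ukT: "uk T = U k" using xkn[of k] ukn[of k] by (simp_all add: node_last[OF k])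
    have le_D: "c j \<le> D" if "\<And>j. 0 \<le> c j" "(\<Sum>j<k. c j) \<le> D" "j < k" for c :: "nat \<Rightarrow> real" and j
      using member_le_sum[of j "{..<k}" c] that by simp

    \<comment> \<open>Structure, constraints and discrete inclusion\<close>
    have 1: "piecewise_linear T k xk" "piecewise_linear T k uk"
      unfolding xk_def uk_def by (rule piecewise_linear_mesh_linear[OF Tk])+
    have 2: "piecewise_constant T k ak"
      unfolding piecewise_constant_def
    proof (intro allI impI ballI)
      fix j t assume j: "j < k" and t: "t \<in> {node T k j..<node T k (Suc j)}"
      show "ak t = ak (node T k j)"
        using mesh_index_eq[OF T j t] akn[OF j] by (simp add: ak_def)
    qed
    have dxk_eq: "dxk = (\<lambda>t. (X (Suc (mesh_index T k t)) - X (mesh_index T k t)) /\<^sub>R step T k)"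
      by (rule ext) (simp add: dxk_def v[OF idx])
    have 3: "is_derivative T xk dxk" "is_derivative T uk duk"
      using is_derivative_mesh_linear[OF Tk, of X] is_derivative_mesh_linear[OF Tk, of U]
      by (simp_all add: xk_def uk_def dxk_eq duk_def[abs_def] d_def)
    have 4: "uk (node T k j) \<in> (\<Inter>i. \<nu> i -` {..<L\<nu> * \<epsilon> k}) \<and> ak (node T k j) \<in> A" if j: "j \<le> k" for j
    proof -
      have "\<nu> i (U j) < L\<nu> * \<epsilon> k" for i
      proof -
        have "\<nu> i (u (node T k j)) \<le> 0"
          using inU[OF node_in_interval[OF Tk j]] by (simp add: U_set_def U_comp_def)
        moreover have "\<bar>\<nu> i (U j) - \<nu> i (u (node T k j))\<bar> \<le> L\<nu> * E k"
          by (rule order_trans[OF nulip mult_left_mono[OF UE[OF j]]]) (use Lnu in simp)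
        moreover have "L\<nu> * E k < L\<nu> * \<epsilon> k" using Lnu s by (simp add: \<epsilon>_def)
        ultimately show ?thesis by linarith
      qed
      \<comment> \<open>This includes \<open>j = k\<close>: at the final node the value is
        \<open>b (k - 1)\<close>.\<close>
      moreover have "ak (node T k j) \<in> A" unfolding ak_def by (rule bA[OF idx])
      ultimately show ?thesis using ukn[OF j] by simp
    qed
    have 5: "(xk T, T) \<in> {y + \<epsilon> k *\<^sub>R b | y b. y \<in> \<Xi>x \<and> b \<in> ball 0 1} \<times> \<Xi>T"
    proof -
      have lt: "norm (X k - x T) < \<epsilon> k" using XE[of k] s by (simp add: node_last[OF k] \<epsilon>_def)
      then have pos: "0 < \<epsilon> k" using norm_ge_zero[of "X k - x T"] by linarith
      have "norm ((X k - x T) /\<^sub>R \<epsilon> k) = norm (X k - x T) / \<epsilon> k"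
        using pos by (simp add: divide_inverse mult.commute)
      then have "norm ((X k - x T) /\<^sub>R \<epsilon> k) < 1" using lt pos by simp
      moreover have "xk T = x T + \<epsilon> k *\<^sub>R ((X k - x T) /\<^sub>R \<epsilon> k)" using pos by (simp add: xkT)
      ultimately have "xk T \<in> {y + \<epsilon> k *\<^sub>R b | y b. y \<in> \<Xi>x \<and> b \<in> ball 0 1}"
        using xT(1) by (intro CollectI exI[of _ "x T"] exI[of _ "(X k - x T) /\<^sub>R \<epsilon> k"]) simp
      then show ?thesis using xT(2) by simp
    qed
    have 6: "(\<forall>t\<in>{node T k j..node T k (Suc j)}. xk t = xk (node T k j) + (t - node T k j) *\<^sub>R v j) \<and>
           - v j \<in> vel_map f g (xk (node T k j)) (uk (node T k j)) (ak (node T k j))" if j: "j < k" for j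
    proof
      show "\<forall>t\<in>{node T k j..node T k (Suc j)}. xk t = xk (node T k j) + (t - node T k j) *\<^sub>R v j"
        using mesh_linear_eq[OF T j, of _ X] v[OF j, symmetric] xkn[of j] j
        by (simp add: xk_def divide_inverse)
      show "- v j \<in> vel_map f g (xk (node T k j)) (uk (node T k j)) (ak (node T k j))"
        using vN[OF j] j xkn[of j] ukn[of j] akn[OF j]
        by (auto simp: vel_map_def intro!: exI[of _ "f (X j) (b j) - v j"])
    qed
    have 7: "g i (xk 0 - uk 0) \<ge> 0" for i
      using x0 by (auto simp: xk0 uk0 XU0 C_moved_def C_set_def C_comp_def)

    \<comment> \<open>Uniform and L2 errors\<close>
    have 8: "norm (xk t - x t) \<le> E k + D * step T k \<and> norm (uk t - u t) \<le> E k + D * step T k" if t: "t \<in> {0..T}" for t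
      unfolding xk_def uk_def
    proof (intro conjI mesh_linear_near[OF Tk acx dx _ _ t] mesh_linear_near[OF Tk acu du _ _ t])
      fix j r assume j: "j < k" and r: "r \<in> {node T k j..node T k (Suc j)}"
      show "norm ((X (Suc j) - X j) /\<^sub>R step T k - dx r) \<le> D"
        using cx[OF j r] le_D[OF c0(1) cs(1) j] v[OF j] by simp
      show "norm ((U (Suc j) - U j) /\<^sub>R step T k - du r) \<le> D"
        using cu[OF j r] le_D[OF c0(2) cs(2) j] by simp
    qed (use XE UE in auto)
    have 9: "(\<lambda>t. dxk t - dx t) \<in> L2_space T \<and> L2_norm T (\<lambda>t. dxk t - dx t) \<le> sqrt (step T k) * D"
    proof (rule L2_norm_mesh_bound[OF Tk, where c = cx])
      show "(\<lambda>t. dxk t - dx t) \<in> borel_measurable (lebesgue_on {0..T})"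
        unfolding dxk_def by (intro borel_measurable_diff mesh_step_measurable meas)
    qed (use cx[OF idx mesh_index_bounds[OF Tk]] c0 cs in \<open>auto simp: dxk_def\<close>)
    have 10: "(\<lambda>t. duk t - du t) \<in> L2_space T \<and> L2_norm T (\<lambda>t. duk t - du t) \<le> sqrt (step T k) * D"
    proof (rule L2_norm_mesh_bound[OF Tk, where c = cu])
      show "(\<lambda>t. duk t - du t) \<in> borel_measurable (lebesgue_on {0..T})"
        unfolding duk_def by (intro borel_measurable_diff mesh_step_measurable meas)
    qed (use cu[OF idx mesh_index_bounds[OF Tk]] c0 cs in \<open>auto simp: duk_def d_def\<close>)
    have 11: "(\<lambda>t. ak t - a t) \<in> L2_space T \<and> L2_norm T (\<lambda>t. ak t - a t) \<le> sqrt (step T k) * D"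
    proof (rule L2_norm_mesh_bound[OF Tk, where c = ca])
      show "(\<lambda>t. ak t - a t) \<in> borel_measurable (lebesgue_on {0..T})"
        unfolding ak_def by (intro borel_measurable_diff mesh_step_measurable meas)
    qed (use ca[OF idx mesh_index_bounds[OF Tk]] c0 cs in \<open>auto simp: ak_def\<close>)

    \<comment> \<open>Variation of the control slopes and slopes of the end cells\<close>
    have 12: "total_variation duk 0 T \<le> ennreal (mu_tilde Lf T \<mu>)"
    proof -
      have "(\<Sum>l<k - 1. norm (d (Suc l) - d l)) \<le> mu_tilde Lf T \<mu>"
        using var muK unfolding d_def by linarith
      then show ?thesis
        using total_variation_mesh_step_le[OF Tk, of d] unfolding duk_def[abs_def] by (meson ennreal_leI order_trans)
    qed
    \<comment> \<open>The slope of \<open>U\<close> differs from that of \<open>u\<close> by at most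
      \<open>\<mu> + K\<close>, so a slope of \<open>u\<close> bounded by \<mu> gives
      \<open>2 * \<mu> + K\<close>, below \<open>3 * \<mu> + 2 * K\<close>. The hypothesis on the
      end quotients supplies this for \<open>j = 0\<close> and \<open>j = k - 1\<close>.\<close>
    have slope_le: "norm (d j) \<le> mu_tilde Lf T \<mu>"
      if "j < k" "norm ((u (node T k (Suc j)) - u (node T k j)) /\<^sub>R step T k) \<le> \<mu>" for j
    proof -
      have "norm (d j) \<le> norm (d j - (u (node T k (Suc j)) - u (node T k j)) /\<^sub>R step T k)
          + norm ((u (node T k (Suc j)) - u (node T k j)) /\<^sub>R step T k)"
        by (subst add.commute) (rule norm_triangle_sub)
      then show ?thesis using slope[OF that(1)] that(2) muK K0 mu unfolding d_def by linarith
    qed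
    have ends: "norm ((u (node T k 1) - u 0) /\<^sub>R step T k) \<le> \<mu>"
      "norm ((u T - u (node T k (k - 1))) /\<^sub>R step T k) \<le> \<mu>"
      using assms(15)[rule_format, OF k] by simp_all
    have 13: "norm ((uk (node T k 1) - uk 0) /\<^sub>R step T k) \<le> mu_tilde Lf T \<mu>"
      using slope_le[of 0] ends(1) k ukn[of 1] by (simp add: d_def uk0)
    have 14: "norm ((uk T - uk (node T k (k - 1))) /\<^sub>R step T k) \<le> mu_tilde Lf T \<mu>"
      using slope_le[of "k - 1"] ends(2) k ukn[of "k - 1"] node_last[OF k, of T] by (simp add: d_def ukT)
    have "R k xk uk ak dxk duk v"
      unfolding R_def using 1 2 3 4 5 6 7 8 9 10 11 12 13 14 by (intro conjI allI impI ballI max.boundedI) blast+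
    then show ?thesis by blast
  qed

  \<comment> \<open>Passage to the limit over the meshes\<close>
  then obtain xk uk ak dxk duk v where R: "\<And>k. 1 \<le> k \<Longrightarrow> R k (xk k) (uk k) (ak k) (dxk k) (duk k) (v k)" by metis
  have ev: "\<forall>\<^sub>F k::nat in sequentially. 1 \<le> k" by (rule eventually_ge_at_top)
  have bound0: "(\<lambda>k. E k + D * step T k) \<longlonglongrightarrow> 0"
    using tendsto_add[OF E0 tendsto_mult_left[OF step0, of D]] by simp
  have unif: "uniform_limit {0..T} yk y sequentially"
    if "\<And>k t. \<lbrakk>1 \<le> k; t \<in> {0..T}\<rbrakk> \<Longrightarrow> norm (yk k t - y t) \<le> E k + D * step T k"
    for yk :: "nat \<Rightarrow> real \<Rightarrow> real^'n" and y
  proof (rule uniform_limitI)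
    fix e :: real assume "0 < e"
    from order_tendstoD(2)[OF bound0 this] ev
    show "\<forall>\<^sub>F k in sequentially. \<forall>t\<in>{0..T}. dist (yk k t) (y t) < e"
      by eventually_elim (use that in \<open>force simp: dist_norm\<close>)
  qed
  have rate0: "(\<lambda>k. sqrt (step T k) * D) \<longlonglongrightarrow> 0"
    using tendsto_mult_right[OF tendsto_real_sqrt[OF step0], of D] by simp
  have eps_pos: "0 < \<epsilon> k" if "1 \<le> k" for k
    using step_pos[OF T that] mu by (simp add: \<epsilon>_def E_def add_nonneg_pos)
  have eps0: "\<epsilon> \<longlonglongrightarrow> 0" unfolding \<epsilon>_def using tendsto_add[OF E0 step0] by simp
  note R' = R[unfolded R_def]
  show ?thesis
  proof (rule exI[of _ \<epsilon>], rule exI[of _ \<epsilon>], rule exI[of _ xk], rule exI[of _ uk], rule exI[of _ ak],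
      rule exI[of _ dxk], rule exI[of _ duk], rule exI[of _ v], intro conjI)
    show "\<forall>k\<ge>1. 0 < \<epsilon> k \<and> 0 < \<epsilon> k" using eps_pos by blast
    show "uniform_limit {0..T} xk x sequentially" by (rule unif) (use R' in blast)
    show "uniform_limit {0..T} uk u sequentially" by (rule unif) (use R' in blast)
    show "L2_tendsto T dxk dx" by (rule L2_tendstoI[OF _ rate0]) (use R' in blast)
    show "L2_tendsto T duk du" by (rule L2_tendstoI[OF _ rate0]) (use R' in blast)
    show "L2_tendsto T ak a" by (rule L2_tendstoI[OF _ rate0]) (use R' in blast)
  qed (use R' eps0 in blast)+
qed

end
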